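(* Let $\alpha,\beta,\gamma\in(0,1)$ and, for $\bm x\in[0,\infty)^3$, let $$g(\bm x)=\begin{cases}(1/\gamma)(1/\alpha-1)(x_2-x_1)+\left(x_2^{1/\beta}+x_3^{1/\beta}\right)^\beta,&0\le x_1\le x_2,\\[4pt] x_2+\left[\left\{(x_1-x_2)/\alpha\right\}^{1/\gamma}+\left\{\left(x_2^{1/\beta}+x_3^{1/\beta}\right)^\beta-x_2\right\}^{1/\gamma}\right]^\gamma,&0\le x_2<x_1,\end{cases}$$ the gauge function of the trivariate vine copula with $C_{12}$ logistic (parameter $\alpha$), $C_{23}$ inverted logistic (parameter $\beta$) and $C_{13|2}$ inverted logistic (parameter $\gamma$). Then $\eta_{\{1,3\}}=\{\min_{x_1,x_3\ge1,\,x_2\ge0}g(\bm x)\}^{-1}$ equals $g(1,v,1)^{-1}$, where $$g(1,v,1)=v+\left[\left\{(1-v)/\alpha\right\}^{1/\gamma}+\left\{(1+v^{1/\beta})^\beta-v\right\}^{1/\gamma}\right]^\gamma$$ and $v\in(0,1)$ is the unique solution in $(0,1)$ of $$1+\left[\left\{\frac{1-v}{\alpha}\right\}^{1/\gamma}+\left\{(1+v^{1/\beta})^\beta-v\right\}^{1/\gamma}\right]^{\gamma-1}\left[-\alpha^{-1/\gamma}(1-v)^{-1+1/\gamma}+\left\{(1+v^{1/\beta})^\beta-v\right\}^{-1+1/\gamma}\left\{(1+v^{-1/\beta})^{\beta-1}-1\right\}\right]=0.$$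
   Context: Logistic and inverted logistic copulas are the extreme value copula $C(u,v)=\exp\{-V(\frac{-1}{\ln u},\frac{-1}{\ln v})\}$ and inverted extreme value copula $C(u,v)=u+v-1+\exp[-V\{\frac{-1}{\ln(1-u)},\frac{-1}{\ln(1-v)}\}]$ with exponent measure $V(x,y)=(x^{-1/\alpha}+y^{-1/\alpha})^\alpha$. The gauge function of a joint density $f$ with standard exponential margins is the function $g$, homogeneous of order 1, with $-\ln f(t\bm x)\sim tg(\bm x)$ as $t\to\infty$. The coefficient of tail dependence $\eta_{\{1,3\}}$ of $(X_1,X_3)$ is taken in its gauge-function form as in the claim. *)

theory Defs
  imports "HOL-Analysis.Analysis" "HOL-Library.Landau_Symbols"
begin

definition logistic_V :: "real \<Rightarrow> real \<Rightarrow> real \<Rightarrow> real" where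
  "logistic_V \<alpha> x y = (x powr (- 1 / \<alpha>) + y powr (- 1 / \<alpha>)) powr \<alpha>"

definition ev_copula :: "(real \<Rightarrow> real \<Rightarrow> real) \<Rightarrow> real \<Rightarrow> real \<Rightarrow> real" where
  "ev_copula V u v = exp (- V (- 1 / ln u) (- 1 / ln v))"

definition inverted_ev_copula :: "(real \<Rightarrow> real \<Rightarrow> real) \<Rightarrow> real \<Rightarrow> real \<Rightarrow> real" where
  "inverted_ev_copula V u v = u + v - 1 + exp (- V (- 1 / ln (1 - u)) (- 1 / ln (1 - v)))"

definition copula_density :: "(real \<Rightarrow> real \<Rightarrow> real) \<Rightarrow> real \<Rightarrow> real \<Rightarrow> real" where
  "copula_density C u v = deriv (\<lambda>s. deriv (\<lambda>t. C s t) v) u"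

text \<open>
  Joint density, in standard exponential margins, of the trivariate (simplified) vine copula with
  edges 12, 23 and 13|2.  The arguments of the density of the pair copula 13|2 are the conditional
  distribution functions of the first and third variable given the second, that is, the partial
  derivatives of the copulas 12 and 23 with respect to the second variable.
\<close>

definition vine_density ::
  "(real \<Rightarrow> real \<Rightarrow> real) \<Rightarrow> (real \<Rightarrow> real \<Rightarrow> real) \<Rightarrow> (real \<Rightarrow> real \<Rightarrow> real) \<Rightarrow> real ^ 3 \<Rightarrow> real" where
  "vine_density C12 C23 C13 x =
    (let u1 = 1 - exp (- x $ 1); u2 = 1 - exp (- x $ 2); u3 = 1 - exp (- x $ 3) in
      copula_density C12 u1 u2 * copula_density C23 u2 u3
      * copula_density C13 (deriv (\<lambda>t. C12 u1 t) u2) (deriv (\<lambda>s. C23 s u3) u2)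
      * (exp (- x $ 1) * exp (- x $ 2) * exp (- x $ 3)))"

text \<open>
  The limit relation is required on the open orthant: a density in exponential margins may be zero
  or undefined where some coordinate vanishes (for \<open>x $ 1 = 0\<close> and the vine below it is not
  a positive finite number).  Continuity then determines the gauge function on the closed orthant.
\<close>

definition is_gauge_function :: "(real ^ 'n \<Rightarrow> real) \<Rightarrow> (real ^ 'n \<Rightarrow> real) \<Rightarrow> bool" where
  "is_gauge_function f g \<longleftrightarrow>
    continuous_on {x. \<forall>i. 0 \<le> x $ i} g \<and>
    (\<forall>x t. (\<forall>i. 0 \<le> x $ i) \<longrightarrow> 0 \<le> t \<longrightarrow> g (t *\<^sub>R x) = t * g x) \<and>
    (\<forall>x. (\<forall>i. 0 < x $ i) \<longrightarrow>
      (\<lambda>t. - ln (f (t *\<^sub>R x))) \<sim>[at_top] (\<lambda>t. t * g x))"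

definition tail_region :: "'n set \<Rightarrow> (real ^ 'n) set" where
  "tail_region A = {x. \<forall>i. (if i \<in> A then 1 else 0) \<le> x $ i}"

definition is_minimum :: "real set \<Rightarrow> real \<Rightarrow> bool" where
  "is_minimum S m \<longleftrightarrow> m \<in> S \<and> (\<forall>s\<in>S. m \<le> s)"

definition tail_dep_coeff :: "'n set \<Rightarrow> (real ^ 'n \<Rightarrow> real) \<Rightarrow> real" where
  "tail_dep_coeff A g = inverse (THE m. is_minimum (g ` tail_region A) m)"

definition vine_gauge :: "real \<Rightarrow> real \<Rightarrow> real \<Rightarrow> real ^ 3 \<Rightarrow> real" where
  "vine_gauge \<alpha> \<beta> \<gamma> x =
    (if x $ 1 \<le> x $ 2
     then (1 / \<gamma>) * (1 / \<alpha> - 1) * (x $ 2 - x $ 1)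
          + (x $ 2 powr (1 / \<beta>) + x $ 3 powr (1 / \<beta>)) powr \<beta>
     else x $ 2
          + (((x $ 1 - x $ 2) / \<alpha>) powr (1 / \<gamma>)
             + ((x $ 2 powr (1 / \<beta>) + x $ 3 powr (1 / \<beta>)) powr \<beta> - x $ 2) powr (1 / \<gamma>)) powr \<gamma>)"

end

theory Submission imports Defs begin

text \<open>
  Write \<open>N\<^sub>\<alpha>\<close> for the norm with exponent \<open>1/\<alpha>\<close> on pairs of nonnegative reals (\<open>lnorm\<close>).
  The logistic copula is \<open>exp (- N\<^sub>\<alpha> (- ln u) (- ln v))\<close>, and the inverted copula is
  \<open>u + v - 1\<close> plus the same expression at \<open>(1 - u, 1 - v)\<close>, so everything about the
  inverted copulas follows from the logistic one by reflection.  The conditional distribution function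
  of the logistic copula is \<open>exp (- z)\<close> and the density is \<open>exp L\<close>, where \<open>z\<close> (\<open>cond_exponent\<close>) and
  \<open>L\<close> (\<open>log_density\<close>) are combinations of \<open>a\<close>, \<open>b\<close>, \<open>N\<^sub>\<alpha> a b\<close>
  and their logarithms.

  The logarithm of the vine density is thereby a sum of three \<open>L\<close> terms and a linear one.  Along a
  ray, the arguments of these terms may grow linearly, stay bounded or decay exponentially, and a case
  distinction on the position of the ray seems to be called for.  It disappears when one records, for
  a positive function \<open>f\<close>, the two limits of \<open>f t / t\<close> and of \<open>ln (f t) / t\<close>
  (\<open>has_rates\<close>).  Such pairs of rates propagate through \<open>N\<^sub>\<alpha>\<close> and
  \<open>z\<close> by explicit formulas, the map \<open>y \<mapsto> - ln (1 - exp (- y))\<close>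
  relating a copula to its inverted form swaps the two rates and negates them
  (\<open>has_rates_exp_dual\<close>), and they determine the growth of \<open>L\<close>
  (\<open>log_density_rate\<close>).  Both cases of the gauge function come out of one formula
  (\<open>vine_gauge_eq\<close>) in the positive parts of \<open>x\<^sub>2 - x\<^sub>1\<close> and \<open>x\<^sub>1 - x\<^sub>2\<close>,
  from which continuity and homogeneity are also visible.

  For the minimum, monotonicity of the norms allows \<open>x\<^sub>1\<close> and \<open>x\<^sub>3\<close> to be lowered
  to \<open>1\<close> and \<open>x\<^sub>2\<close> to be restricted to the unit interval
  (\<open>vine_gauge_ge_profile\<close>).  What remains is a strictly convex function of one variable.
  Convexity is used in the form of a tangent inequality (\<open>profile_tangent\<close>), obtained from the
  supporting hyperplanes of the norm, that is, from Hoelder's inequality: the graph lies strictly above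
  the line whose slope is the left-hand side of the stationarity equation.  Hence at a
  stationary point the function is strictly smaller than anywhere else, so there is at most one such
  point, and it is the minimiser.  Existence follows from the intermediate value theorem, as the slope is negative at
  \<open>0\<close> and positive at \<open>1\<close>.
\<close>

section \<open>The norm with exponent \<open>1/\<alpha>\<close>\<close>

definition lnorm :: "real \<Rightarrow> real \<Rightarrow> real \<Rightarrow> real" where
  "lnorm \<alpha> a b = (a powr (1 / \<alpha>) + b powr (1 / \<alpha>)) powr \<alpha>"

lemma lnorm_commute: "lnorm \<alpha> a b = lnorm \<alpha> b a"
  by (simp add: lnorm_def add.commute)

lemma lnorm_zero: "0 < \<alpha> \<Longrightarrow> 0 \<le> b \<Longrightarrow> lnorm \<alpha> 0 b = b"
  by (simp add: lnorm_def powr_powr)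

lemma lnorm_scale:
  assumes "0 < \<alpha>" "0 \<le> c" "0 \<le> a" "0 \<le> b"
  shows "lnorm \<alpha> (c * a) (c * b) = c * lnorm \<alpha> a b"
proof -
  have "lnorm \<alpha> (c * a) (c * b) = (c powr (1 / \<alpha>) * (a powr (1 / \<alpha>) + b powr (1 / \<alpha>))) powr \<alpha>"
    using assms by (simp add: lnorm_def powr_mult algebra_simps)
  also have "\<dots> = c * lnorm \<alpha> a b"
    using assms by (simp add: lnorm_def powr_mult powr_powr)
  finally show ?thesis .
qed

lemma lnorm_mono:
  assumes "0 < \<alpha>" "0 \<le> a" "a \<le> a'" "0 \<le> b" "b \<le> b'"
  shows "lnorm \<alpha> a b \<le> lnorm \<alpha> a' b'"
  unfolding lnorm_def using assms by (intro powr_mono2 add_mono) auto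

lemma lnorm_ge: "0 < \<alpha> \<Longrightarrow> 0 \<le> a \<Longrightarrow> 0 \<le> b \<Longrightarrow> b \<le> lnorm \<alpha> a b"
  using lnorm_mono[of \<alpha> 0 a b b] lnorm_zero[of \<alpha> b] by simp

lemma lnorm_ge_left: "0 < \<alpha> \<Longrightarrow> 0 \<le> a \<Longrightarrow> 0 \<le> b \<Longrightarrow> a \<le> lnorm \<alpha> a b"
  using lnorm_ge[of \<alpha> b a] by (simp add: lnorm_commute)

lemma lnorm_gt:
  assumes "0 < \<alpha>" "0 < a" "0 \<le> b"
  shows "b < lnorm \<alpha> a b"
proof -
  have "(b powr (1 / \<alpha>)) powr \<alpha> < (a powr (1 / \<alpha>) + b powr (1 / \<alpha>)) powr \<alpha>"
    using assms by (intro powr_less_mono2) auto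
  then show ?thesis using assms by (simp add: lnorm_def powr_powr)
qed

lemma lnorm_pos: "0 < a \<Longrightarrow> 0 < lnorm \<alpha> a b"
  by (simp add: lnorm_def add_pos_nonneg less_imp_neq[THEN not_sym])

lemma lnorm_powr:
  assumes "0 < \<alpha>"
  shows "lnorm \<alpha> a b powr (1 / \<alpha>) = a powr (1 / \<alpha>) + b powr (1 / \<alpha>)"
  using assms by (simp add: lnorm_def powr_powr)

lemma lnorm_le_max:
  assumes "0 < \<alpha>" "\<alpha> < 1" "0 \<le> a" "0 \<le> b"
  shows "lnorm \<alpha> a b \<le> 2 * max a b"
proof -
  have "lnorm \<alpha> a b \<le> lnorm \<alpha> (max a b * 1) (max a b * 1)"
    using assms by (intro lnorm_mono) auto
  also have "\<dots> = max a b * 2 powr \<alpha>"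
    using assms by (subst lnorm_scale) (auto simp: lnorm_def)
  also have "\<dots> \<le> max a b * 2 powr 1"
    using assms by (intro mult_left_mono powr_mono) auto
  finally show ?thesis by simp
qed

lemma DERIV_lnorm:
  assumes "0 < \<alpha>" "0 < a" "0 < b"
  shows "((\<lambda>a. lnorm \<alpha> a b) has_real_derivative (a / lnorm \<alpha> a b) powr (1 / \<alpha> - 1)) (at a)"
proof -
  define S where "S = a powr (1 / \<alpha>) + b powr (1 / \<alpha>)"
  have S: "0 < S" using assms by (simp add: S_def add_pos_pos)
  have "((\<lambda>a. lnorm \<alpha> a b) has_real_derivative
      \<alpha> * S powr (\<alpha> - 1) * ((1 / \<alpha>) * a powr (1 / \<alpha> - 1))) (at a)"
    unfolding lnorm_def S_def using assms S
    by (auto intro!: derivative_eq_intros simp: S_def)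
  moreover have "\<alpha> * S powr (\<alpha> - 1) * ((1 / \<alpha>) * a powr (1 / \<alpha> - 1))
      = (a / lnorm \<alpha> a b) powr (1 / \<alpha> - 1)"
  proof -
    have "lnorm \<alpha> a b powr (1 / \<alpha> - 1) = S powr (1 - \<alpha>)"
      using assms by (simp add: lnorm_def S_def powr_powr right_diff_distrib)
    moreover have "S powr (1 - \<alpha>) = inverse (S powr (\<alpha> - 1))"
      by (metis minus_diff_eq powr_minus)
    ultimately show ?thesis using assms S lnorm_pos[of a \<alpha> b]
      by (simp add: powr_divide field_simps)
  qed
  ultimately show ?thesis by simp
qed

lemma tendsto_lnorm:
  assumes "0 < \<alpha>" "\<forall>\<^sub>F t in F. 0 \<le> f t" "\<forall>\<^sub>F t in F. 0 \<le> h t" "(f \<longlongrightarrow> a) F" "(h \<longlongrightarrow> b) F"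
  shows "((\<lambda>t. lnorm \<alpha> (f t) (h t)) \<longlongrightarrow> lnorm \<alpha> a b) F"
  unfolding lnorm_def using assms
  by (intro tendsto_powr' tendsto_add) auto

lemma continuous_on_lnorm [continuous_intros]:
  assumes "0 < \<alpha>" "continuous_on S f" "continuous_on S h" "\<And>x. x \<in> S \<Longrightarrow> 0 \<le> f x" "\<And>x. x \<in> S \<Longrightarrow> 0 \<le> h x"
  shows "continuous_on S (\<lambda>x. lnorm \<alpha> (f x) (h x))"
  unfolding lnorm_def using assms
  by (intro continuous_on_powr' continuous_intros) auto

section \<open>Conditional distributions and densities of logistic copulas\<close>

text \<open>
  The exponent is chosen so that \<open>exp (- z)\<close>, with \<open>a = - ln u\<close> and \<open>b = - ln v\<close>,
  is the derivative of the logistic copula in \<open>v\<close>.  Its two summands are positive, which places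
  this conditional distribution function strictly between \<open>0\<close> and \<open>1\<close>.
\<close>

definition cond_exponent :: "real \<Rightarrow> real \<Rightarrow> real \<Rightarrow> real" where
  "cond_exponent \<alpha> a b =
     lnorm \<alpha> a b - b + (1 / \<alpha> - 1) * (ln (lnorm \<alpha> a b) - ln b)"

text \<open>
  The logarithm of the logistic copula density at \<open>a = - ln u\<close> and \<open>b = - ln v\<close>, expanded
  into terms whose growth can be read off separately.
\<close>

definition log_density :: "real \<Rightarrow> real \<Rightarrow> real \<Rightarrow> real" where
  "log_density \<alpha> a b =
     a + b - lnorm \<alpha> a b + (1 / \<alpha> - 1) * (ln a + ln b)
     + (1 - 2 / \<alpha>) * ln (lnorm \<alpha> a b) + ln (lnorm \<alpha> a b + (1 / \<alpha> - 1))"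

lemma cond_exponent_pos:
  assumes "0 < \<alpha>" "\<alpha> < 1" "0 < a" "0 < b"
  shows "0 < cond_exponent \<alpha> a b"
proof -
  have "b < lnorm \<alpha> a b" using assms lnorm_gt by simp
  moreover from this have "ln b < ln (lnorm \<alpha> a b)" using assms by simp
  ultimately show ?thesis using assms
    by (simp add: cond_exponent_def add_pos_pos)
qed

lemma ev_copula_logistic:
  assumes "0 < \<alpha>" "0 < u" "u < 1" "0 < v" "v < 1"
  shows "ev_copula (logistic_V \<alpha>) u v = exp (- lnorm \<alpha> (- ln u) (- ln v))"
proof -
  have "(- 1 / ln w) powr (- 1 / \<alpha>) = (- ln w) powr (1 / \<alpha>)" if "0 < w" "w < 1" for w :: real
  proof -
    have eq: "- 1 / ln w = inverse (- ln w)" by (simp add: field_simps)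
    have "- 1 / \<alpha> = - (1 / \<alpha>)" by simp
    then show ?thesis using that unfolding eq
      by (metis inverse_inverse_eq powr_minus inverse_powr)
  qed
  then show ?thesis using assms by (simp add: ev_copula_def logistic_V_def lnorm_def)
qed

text \<open>
  The partial derivative of the norm is \<open>(b / n) powr (1 / \<alpha> - 1)\<close>; this factor and the factor
  \<open>1 / v = exp b\<close> are absorbed into the exponent.
\<close>

lemma DERIV_logistic_right:
  assumes "0 < \<alpha>" "0 < u" "u < 1" "0 < v" "v < 1"
  shows "((\<lambda>v. ev_copula (logistic_V \<alpha>) u v) has_real_derivative
           exp (- cond_exponent \<alpha> (- ln u) (- ln v))) (at v)"
proof (rule has_field_derivative_transform_within_open[where S = "{0<..<1}"])
  define a b where "a = - ln u" and "b = - ln v"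
  have pos: "0 < a" "0 < b" using assms by (auto simp: a_def b_def)
  define n where "n = lnorm \<alpha> b a"
  have n: "0 < n" "lnorm \<alpha> a b = n" using pos lnorm_pos lnorm_commute by (auto simp: n_def)
  have "((\<lambda>v. exp (- lnorm \<alpha> (- ln v) a)) has_real_derivative
      exp (- n) * (- ((b / n) powr (1 / \<alpha> - 1) * (- inverse v)))) (at v)"
    unfolding n_def b_def using assms pos
    by (intro derivative_intros DERIV_chain2[OF DERIV_lnorm]) (auto simp: DERIV_ln)
  moreover have "exp (- n) * (- ((b / n) powr (1 / \<alpha> - 1) * (- inverse v))) = exp (- cond_exponent \<alpha> a b)"
  proof -
    have "inverse v = exp b" using assms by (simp add: b_def exp_minus)
    moreover have "(b / n) powr (1 / \<alpha> - 1) = exp ((1 / \<alpha> - 1) * (ln b - ln n))"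
      using pos n by (simp add: powr_def ln_div)
    ultimately show ?thesis using n
      by (simp add: cond_exponent_def exp_add[symmetric] algebra_simps)
  qed
  ultimately show "((\<lambda>v. exp (- lnorm \<alpha> (- ln u) (- ln v))) has_real_derivative
      exp (- cond_exponent \<alpha> (- ln u) (- ln v))) (at v)"
    by (simp add: a_def b_def lnorm_commute)
qed (use assms ev_copula_logistic in auto)

lemma DERIV_cond_exponent:
  assumes "0 < \<alpha>" "\<alpha> < 1" "0 < u" "u < 1" "0 < b"
  shows "((\<lambda>u. exp (- cond_exponent \<alpha> (- ln u) b)) has_real_derivative
           exp (log_density \<alpha> (- ln u) b)) (at u)"
proof -
  define a n where "a = - ln u" and "n = lnorm \<alpha> a b"
  have pos: "0 < a" "0 < n" using assms lnorm_pos by (auto simp: a_def n_def)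
  define p where "p = 1 / \<alpha> - 1"
  have p: "0 < p" using assms by (simp add: p_def)
  define D where "D = (a / n) powr p * - inverse u"
  have D: "((\<lambda>u. lnorm \<alpha> (- ln u) b) has_real_derivative D) (at u)"
    unfolding D_def n_def a_def p_def using assms
    by (intro DERIV_chain2[OF DERIV_lnorm] DERIV_minus DERIV_ln) auto
  have "((\<lambda>u. exp (- cond_exponent \<alpha> (- ln u) b)) has_real_derivative
      exp (- cond_exponent \<alpha> a b) * - (D + p * (D / n))) (at u)"
    unfolding cond_exponent_def
    by (rule derivative_eq_intros D refl | use pos in \<open>simp add: a_def n_def p_def divide_inverse\<close>)+
  moreover have "exp (- cond_exponent \<alpha> a b) * - (D + p * (D / n)) = exp (log_density \<alpha> a b)"
  proof -
    have "inverse u = exp a" using assms by (simp add: a_def exp_minus)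
    moreover have "(a / n) powr p = exp (p * (ln a - ln n))"
      using pos by (simp add: powr_def ln_div)
    moreover have "- (D + p * (D / n)) = (a / n) powr p * inverse u * ((n + p) * inverse n)"
      using pos assms by (simp add: D_def distrib_left distrib_right divide_inverse mult.commute mult.left_commute)
    moreover have "(n + p) * inverse n = exp (ln (n + p) - ln n)"
      using pos p by (simp add: exp_diff divide_inverse)
    moreover have "log_density \<alpha> a b
        = - cond_exponent \<alpha> a b + (p * (ln a - ln n) + a + (ln (n + p) - ln n))"
      by (simp add: log_density_def cond_exponent_def n_def[symmetric] p_def algebra_simps add_divide_distrib)
    ultimately show ?thesis by (simp only: exp_add mult.assoc)
  qed
  ultimately show ?thesis by (simp add: a_def)
qed

lemma deriv_cong_open:
  fixes f g :: "real \<Rightarrow> real"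
  assumes "open S" "x \<in> S" "\<And>y. y \<in> S \<Longrightarrow> f y = g y"
  shows "deriv f x = deriv g x"
  using assms by (intro deriv_cong_ev) (auto simp: eventually_nhds)

lemma logistic_density:
  assumes "0 < \<alpha>" "\<alpha> < 1" "0 < u" "u < 1" "0 < v" "v < 1"
  shows "copula_density (ev_copula (logistic_V \<alpha>)) u v = exp (log_density \<alpha> (- ln u) (- ln v))"
proof -
  have "copula_density (ev_copula (logistic_V \<alpha>)) u v
      = deriv (\<lambda>s. exp (- cond_exponent \<alpha> (- ln s) (- ln v))) u"
    unfolding copula_density_def using assms
    by (intro deriv_cong_open[of "{0<..<1}"] DERIV_imp_deriv DERIV_logistic_right) auto
  also have "\<dots> = exp (log_density \<alpha> (- ln u) (- ln v))"
    using assms by (intro DERIV_imp_deriv DERIV_cond_exponent) auto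
  finally show ?thesis .
qed

text \<open>
  Inversion is reflection in the centre of the unit square, so derivatives of inverted copulas
  reduce to those of the logistic copula at \<open>(1 - u, 1 - v)\<close>.
\<close>

lemma inverted_ev_copula_eq:
  "inverted_ev_copula V u v = u + v - 1 + ev_copula V (1 - u) (1 - v)"
  by (simp add: inverted_ev_copula_def ev_copula_def)

lemma DERIV_inverted_right:
  assumes "0 < \<alpha>" "0 < u" "u < 1" "0 < v" "v < 1"
  shows "((\<lambda>v. inverted_ev_copula (logistic_V \<alpha>) u v) has_real_derivative
           1 - exp (- cond_exponent \<alpha> (- ln (1 - u)) (- ln (1 - v)))) (at v)"
  unfolding inverted_ev_copula_eq using assms
  by (auto intro!: derivative_eq_intros DERIV_chain2[OF DERIV_logistic_right])

lemma inverted_commute: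
  "inverted_ev_copula (logistic_V \<alpha>) u v = inverted_ev_copula (logistic_V \<alpha>) v u"
  by (simp add: inverted_ev_copula_def logistic_V_def add.commute)

lemma inverted_density:
  assumes "0 < \<alpha>" "\<alpha> < 1" "0 < u" "u < 1" "0 < v" "v < 1"
  shows "copula_density (inverted_ev_copula (logistic_V \<alpha>)) u v
    = exp (log_density \<alpha> (- ln (1 - u)) (- ln (1 - v)))"
proof -
  have "copula_density (inverted_ev_copula (logistic_V \<alpha>)) u v
      = deriv (\<lambda>s. 1 - exp (- cond_exponent \<alpha> (- ln (1 - s)) (- ln (1 - v)))) u"
    unfolding copula_density_def using assms
    by (intro deriv_cong_open[of "{0<..<1}"] DERIV_imp_deriv DERIV_inverted_right) auto
  also have "\<dots> = exp (log_density \<alpha> (- ln (1 - u)) (- ln (1 - v)))"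
  proof (rule DERIV_imp_deriv)
    have "((\<lambda>s. 1 - s) has_real_derivative - 1) (at u)"
      by (auto intro!: derivative_eq_intros)
    from DERIV_chain2[OF DERIV_cond_exponent this, of \<alpha> "- ln (1 - v)"]
    show "((\<lambda>s. 1 - exp (- cond_exponent \<alpha> (- ln (1 - s)) (- ln (1 - v)))) has_real_derivative
        exp (log_density \<alpha> (- ln (1 - u)) (- ln (1 - v)))) (at u)"
      using assms by (auto dest: DERIV_diff[OF DERIV_const[of 1]])
  qed
  finally show ?thesis .
qed

section \<open>Linear and exponential rates of growth\<close>

text \<open>
  At most one of the two rates is nonzero: linear growth forces the second limit to vanish, and
  exponential decay the first.  Keeping both lets one calculus treat all regimes.
\<close>

definition has_rates :: "(real \<Rightarrow> real) \<Rightarrow> real \<Rightarrow> real \<Rightarrow> bool" where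
  "has_rates f a l \<longleftrightarrow> (\<forall>\<^sub>F t in at_top. 0 < f t) \<and>
     ((\<lambda>t. f t / t) \<longlongrightarrow> a) at_top \<and> ((\<lambda>t. ln (f t) / t) \<longlongrightarrow> l) at_top"

lemma const_over_tendsto_0: "((\<lambda>t::real. c / t) \<longlongrightarrow> 0) at_top"
  by (rule tendsto_divide_0[OF tendsto_const filterlim_at_top_imp_at_infinity[OF filterlim_ident]])

lemma ln_mult_over_tendsto_0: "((\<lambda>t. ln (c * t) / t) \<longlongrightarrow> 0) at_top" if "0 < c" for c :: real
proof (rule Lim_transform_eventually)
  show "((\<lambda>t. ln c / t + ln t / t) \<longlongrightarrow> 0) at_top"
    using tendsto_add[OF const_over_tendsto_0[of "ln c"] ln_x_over_x_tendsto_0] by simp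
  show "\<forall>\<^sub>F t in at_top. ln c / t + ln t / t = ln (c * t) / t"
    using eventually_gt_at_top[of 0]
    by eventually_elim (use that in \<open>simp add: ln_mult add_divide_distrib\<close>)
qed

lemma has_rates_linear: "0 < x \<Longrightarrow> has_rates (\<lambda>t. t * x) x 0"
  unfolding has_rates_def
proof (intro conjI)
  assume x: "0 < x"
  show "\<forall>\<^sub>F t in at_top. 0 < t * x"
    using eventually_gt_at_top[of 0] by eventually_elim (use x in simp)
  have "\<forall>\<^sub>F t::real in at_top. t * x / t = x"
    using eventually_gt_at_top[of 0] by eventually_elim simp
  then show "((\<lambda>t. t * x / t) \<longlongrightarrow> x) at_top" by (rule tendsto_eventually)
  show "((\<lambda>t. ln (t * x) / t) \<longlongrightarrow> 0) at_top"
    using ln_mult_over_tendsto_0[OF x] by (simp add: mult.commute)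
qed

text \<open>
  The shift by \<open>c > 0\<close> removes the only way in which a function of at most linear growth can have
  a nonzero logarithmic rate, namely decay to zero.
\<close>

lemma ln_shift_over_tendsto_0:
  fixes f :: "real \<Rightarrow> real"
  assumes "\<forall>\<^sub>F t in at_top. 0 < f t" "((\<lambda>t. f t / t) \<longlongrightarrow> a) at_top" "0 < c"
  shows "((\<lambda>t. ln (f t + c) / t) \<longlongrightarrow> 0) at_top"
proof (rule tendsto_sandwich)
  define K where "K = \<bar>a\<bar> + 1 + c"
  have K: "0 < K" using assms by (simp add: K_def)
  have "\<forall>\<^sub>F t in at_top. f t / t < \<bar>a\<bar> + 1"
    using assms(2) by (rule order_tendstoD) simp
  with assms(1) eventually_ge_at_top[of 1]
  have ev: "\<forall>\<^sub>F t in at_top. 0 < t \<and> c < f t + c \<and> f t + c \<le> K * t"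
  proof eventually_elim
    case (elim t)
    then have "f t < (\<bar>a\<bar> + 1) * t" by (simp add: field_simps)
    moreover have "c * 1 \<le> c * t" using elim assms by (intro mult_left_mono) auto
    ultimately show ?case using elim by (simp add: K_def algebra_simps)
  qed
  show "\<forall>\<^sub>F t in at_top. ln c / t \<le> ln (f t + c) / t"
    using ev by eventually_elim (use assms in \<open>auto intro!: divide_right_mono\<close>)
  show "\<forall>\<^sub>F t in at_top. ln (f t + c) / t \<le> ln (K * t) / t"
    using ev by eventually_elim (use assms K in \<open>auto intro!: divide_right_mono\<close>)
  show "((\<lambda>t. ln c / t) \<longlongrightarrow> 0) at_top" by (rule const_over_tendsto_0)
  show "((\<lambda>t. ln (K * t) / t) \<longlongrightarrow> 0) at_top" using K by (rule ln_mult_over_tendsto_0)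
qed

text \<open>
  If \<open>y = - ln p\<close> then \<open>exp_dual y = - ln (1 - p)\<close>: the passage between the exponential scales
  of the lower and the upper tail of a uniform variable.
\<close>

definition exp_dual :: "real \<Rightarrow> real" where
  "exp_dual y = - ln (1 - exp (- y))"

lemma exp_dual_pos: "0 < y \<Longrightarrow> 0 < exp_dual y"
  by (simp add: exp_dual_def)

lemma exp_dual_involution: "0 < y \<Longrightarrow> exp_dual (exp_dual y) = y"
  by (simp add: exp_dual_def)

text \<open>
  Up to an error that is logarithmic in \<open>y + 1\<close>, the dual is \<open>- ln y\<close>.  As the dual is an
  involution, the same bounds applied to \<open>exp_dual y\<close> show that \<open>y\<close> is close to
  \<open>- ln (exp_dual y)\<close>; this makes the two rates change places.
\<close>

lemma exp_dual_bounds: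
  assumes "0 < y"
  shows "- ln y \<le> exp_dual y" "exp_dual y \<le> ln (y + 1) - ln y"
proof -
  have "1 - exp (- y) \<le> y" using exp_ge_add_one_self[of "- y"] by linarith
  then have "ln (1 - exp (- y)) \<le> ln y" using assms by (subst ln_le_cancel_iff) auto
  then show "- ln y \<le> exp_dual y" by (simp add: exp_dual_def)
  have "exp (- y) \<le> 1 / (1 + y)"
    using exp_ge_add_one_self[of y] assms by (simp add: exp_minus field_simps)
  then have "y / (y + 1) \<le> 1 - exp (- y)" using assms by (simp add: field_simps)
  then have "ln (y / (y + 1)) \<le> ln (1 - exp (- y))" using assms by (subst ln_le_cancel_iff) auto
  then show "exp_dual y \<le> ln (y + 1) - ln y" using assms by (simp add: exp_dual_def ln_div)
qed

lemma has_rates_exp_dual: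
  assumes "has_rates f a l"
  shows "has_rates (\<lambda>t. exp_dual (f t)) (- l) (- a)"
proof -
  have pos: "\<forall>\<^sub>F t in at_top. 0 < f t \<and> 0 < exp_dual (f t) \<and> 0 < t"
    using assms eventually_gt_at_top[of 0] unfolding has_rates_def
    by (auto simp: exp_dual_pos eventually_conj_iff elim: eventually_mono)
  have fa: "((\<lambda>t. f t / t) \<longlongrightarrow> a) at_top" and fl: "((\<lambda>t. ln (f t) / t) \<longlongrightarrow> l) at_top"
    using assms by (auto simp: has_rates_def)
  have d: "((\<lambda>t. exp_dual (f t) / t) \<longlongrightarrow> - l) at_top"
  proof (rule tendsto_sandwich)
    show "((\<lambda>t. - (ln (f t) / t)) \<longlongrightarrow> - l) at_top" using fl by (rule tendsto_minus)
    have "((\<lambda>t. ln (f t + 1) / t) \<longlongrightarrow> 0) at_top"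
      using pos fa by (intro ln_shift_over_tendsto_0[of f a]) (auto elim: eventually_mono)
    from tendsto_diff[OF this fl]
    show "((\<lambda>t. ln (f t + 1) / t - ln (f t) / t) \<longlongrightarrow> - l) at_top" by simp
    show "\<forall>\<^sub>F t in at_top. - (ln (f t) / t) \<le> exp_dual (f t) / t"
      using pos by eventually_elim
        (use divide_right_mono[OF exp_dual_bounds(1)] in fastforce)
    show "\<forall>\<^sub>F t in at_top. exp_dual (f t) / t \<le> ln (f t + 1) / t - ln (f t) / t"
      using pos by eventually_elim
        (use exp_dual_bounds(2) in \<open>auto simp: diff_divide_distrib[symmetric] intro!: divide_right_mono\<close>)
  qed
  have "((\<lambda>t. ln (exp_dual (f t)) / t) \<longlongrightarrow> - a) at_top"
  proof (rule tendsto_sandwich)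
    show "((\<lambda>t. - (f t / t)) \<longlongrightarrow> - a) at_top" using fa by (rule tendsto_minus)
    have "((\<lambda>t. ln (exp_dual (f t) + 1) / t) \<longlongrightarrow> 0) at_top"
      using pos d by (intro ln_shift_over_tendsto_0[of _ "- l"]) (auto elim: eventually_mono)
    from tendsto_diff[OF this fa]
    show "((\<lambda>t. ln (exp_dual (f t) + 1) / t - f t / t) \<longlongrightarrow> - a) at_top" by simp
    show "\<forall>\<^sub>F t in at_top. - (f t / t) \<le> ln (exp_dual (f t)) / t"
      using pos
    proof eventually_elim
      case (elim t)
      then have "- f t \<le> ln (exp_dual (f t))"
        using exp_dual_bounds(1)[of "exp_dual (f t)"] exp_dual_involution[of "f t"] by simp
      then have "- f t / t \<le> ln (exp_dual (f t)) / t"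
        using elim by (intro divide_right_mono) auto
      then show ?case by simp
    qed
    show "\<forall>\<^sub>F t in at_top. ln (exp_dual (f t)) / t \<le> ln (exp_dual (f t) + 1) / t - f t / t"
      using pos
    proof eventually_elim
      case (elim t)
      then have "ln (exp_dual (f t)) \<le> ln (exp_dual (f t) + 1) - f t"
        using exp_dual_bounds(2)[of "exp_dual (f t)"] exp_dual_involution[of "f t"] by simp
      then show ?case using elim
        by (auto simp: diff_divide_distrib[symmetric] intro!: divide_right_mono)
    qed
  qed
  with d pos show ?thesis by (auto simp: has_rates_def elim: eventually_mono)
qed

lemma has_rates_lnorm:
  assumes \<alpha>: "0 < \<alpha>" "\<alpha> < 1" and f: "has_rates f a la" and h: "has_rates h b lb"
  shows "has_rates (\<lambda>t. lnorm \<alpha> (f t) (h t)) (lnorm \<alpha> a b) (max la lb)"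
proof -
  have pos: "\<forall>\<^sub>F t in at_top. 0 < f t \<and> 0 < h t \<and> 0 < t"
    using f h eventually_gt_at_top[of 0] unfolding has_rates_def
    by (auto simp: eventually_conj_iff)
  have "((\<lambda>t. lnorm \<alpha> (f t / t) (h t / t)) \<longlongrightarrow> lnorm \<alpha> a b) at_top"
    using f h pos \<alpha> by (intro tendsto_lnorm) (auto simp: has_rates_def elim!: eventually_mono)
  then have 1: "((\<lambda>t. lnorm \<alpha> (f t) (h t) / t) \<longlongrightarrow> lnorm \<alpha> a b) at_top"
  proof (rule Lim_transform_eventually)
    show "\<forall>\<^sub>F t in at_top. lnorm \<alpha> (f t / t) (h t / t) = lnorm \<alpha> (f t) (h t) / t"
      using pos
    proof eventually_elim
      case (elim t)
      then show ?case using lnorm_scale[of \<alpha> "1 / t" "f t" "h t"] \<alpha> by simp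
    qed
  qed
  have m: "((\<lambda>t. max (ln (f t) / t) (ln (h t) / t)) \<longlongrightarrow> max la lb) at_top"
    using f h by (intro tendsto_max) (auto simp: has_rates_def)
  have "((\<lambda>t. ln (lnorm \<alpha> (f t) (h t)) / t) \<longlongrightarrow> max la lb) at_top"
  proof (rule tendsto_sandwich[OF _ _ m])
    show "((\<lambda>t. ln 2 / t + max (ln (f t) / t) (ln (h t) / t)) \<longlongrightarrow> max la lb) at_top"
      using tendsto_add[OF const_over_tendsto_0[of "ln 2"] m] by simp
    show "\<forall>\<^sub>F t in at_top. max (ln (f t) / t) (ln (h t) / t) \<le> ln (lnorm \<alpha> (f t) (h t)) / t"
      using pos
    proof eventually_elim
      case (elim t)
      then have "f t \<le> lnorm \<alpha> (f t) (h t)" "h t \<le> lnorm \<alpha> (f t) (h t)"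
        using lnorm_ge[of \<alpha> "h t" "f t"] lnorm_ge[of \<alpha> "f t" "h t"] \<alpha> lnorm_commute[of \<alpha> "f t"] by auto
      then show ?case using elim by (auto intro!: divide_right_mono)
    qed
    show "\<forall>\<^sub>F t in at_top. ln (lnorm \<alpha> (f t) (h t)) / t \<le> ln 2 / t + max (ln (f t) / t) (ln (h t) / t)"
      using pos
    proof eventually_elim
      case (elim t)
      have "ln (lnorm \<alpha> (f t) (h t)) \<le> ln (2 * max (f t) (h t))"
        using elim \<alpha> lnorm_le_max[of \<alpha> "f t" "h t"] lnorm_pos[of "f t" \<alpha> "h t"]
        by (subst ln_le_cancel_iff) auto
      also have "\<dots> = ln 2 + ln (max (f t) (h t))"
        using elim by (subst ln_mult) auto
      also have "\<dots> = ln 2 + max (ln (f t)) (ln (h t))"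
        using elim by (auto simp: max_def)
      finally have "ln (lnorm \<alpha> (f t) (h t)) / t \<le> (ln 2 + max (ln (f t)) (ln (h t))) / t"
        using elim by (intro divide_right_mono) auto
      also have "\<dots> = ln 2 / t + max (ln (f t) / t) (ln (h t) / t)"
        using elim by (simp add: add_divide_distrib max_divide_distrib_right)
      finally show ?case .
    qed
  qed
  with 1 pos show ?thesis by (auto simp: has_rates_def lnorm_pos elim: eventually_mono)
qed

text \<open>
  For \<open>n\<close> the norm of \<open>(a, b)\<close>, both bounds on \<open>ln d\<close> come from \<open>ln s \<le> s - 1\<close>,
  applied to the powers \<open>(b / n) powr (1 / \<alpha>)\<close> and
  \<open>(n / b) powr (1 / \<alpha>)\<close>, which equal \<open>1 - (a / n) powr (1 / \<alpha>)\<close> and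
  \<open>1 + (a / b) powr (1 / \<alpha>)\<close>.
\<close>

lemma ln_lnorm_ratio_bounds:
  assumes "0 < \<alpha>" "0 < a" "0 < b"
  defines "d \<equiv> ln (lnorm \<alpha> a b) - ln b"
  shows "0 < d" "ln \<alpha> + (ln a - ln (lnorm \<alpha> a b)) / \<alpha> \<le> ln d" "ln d \<le> ln \<alpha> + (ln a - ln b) / \<alpha>"
proof -
  define n where "n = lnorm \<alpha> a b"
  have n: "0 < n" "b < n" using assms lnorm_gt lnorm_pos by (auto simp: n_def)
  then show d: "0 < d" using assms by (simp add: d_def n_def)
  have np: "n powr (1 / \<alpha>) = a powr (1 / \<alpha>) + b powr (1 / \<alpha>)"
    using assms by (simp add: n_def lnorm_powr)
  have "0 < n powr (1 / \<alpha>)" using n by simp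
  then have "(b / n) powr (1 / \<alpha>) = 1 - (a / n) powr (1 / \<alpha>)"
    using n assms np by (simp add: powr_divide divide_eq_eq left_diff_distrib)
  moreover have "ln ((b / n) powr (1 / \<alpha>)) \<le> (b / n) powr (1 / \<alpha>) - 1"
    using n assms by (intro ln_le_minus_one) simp
  ultimately have "(a / n) powr (1 / \<alpha>) \<le> - ln ((b / n) powr (1 / \<alpha>))" by linarith
  also have "\<dots> = d / \<alpha>" using n assms by (simp add: ln_powr ln_div d_def n_def field_simps)
  finally have "\<alpha> * (a / n) powr (1 / \<alpha>) \<le> d" using assms by (simp add: field_simps)
  then have "ln (\<alpha> * (a / n) powr (1 / \<alpha>)) \<le> ln d" using assms d n by (subst ln_le_cancel_iff) auto
  then show "ln \<alpha> + (ln a - ln (lnorm \<alpha> a b)) / \<alpha> \<le> ln d"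
    using assms n by (simp add: ln_mult ln_powr ln_div n_def)
  have "(n / b) powr (1 / \<alpha>) = 1 + (a / b) powr (1 / \<alpha>)"
    using np n assms by (simp add: powr_divide field_simps)
  moreover have "ln ((n / b) powr (1 / \<alpha>)) \<le> (n / b) powr (1 / \<alpha>) - 1"
    using n assms by (intro ln_le_minus_one) simp
  ultimately have "ln ((n / b) powr (1 / \<alpha>)) \<le> (a / b) powr (1 / \<alpha>)" by linarith
  moreover have "ln ((n / b) powr (1 / \<alpha>)) = d / \<alpha>"
    using n assms by (simp add: ln_powr ln_div d_def n_def)
  ultimately have "d \<le> \<alpha> * (a / b) powr (1 / \<alpha>)" using assms by (simp add: field_simps)
  then have "ln d \<le> ln (\<alpha> * (a / b) powr (1 / \<alpha>))" using assms d by (subst ln_le_cancel_iff) auto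
  then show "ln d \<le> ln \<alpha> + (ln a - ln b) / \<alpha>"
    using assms by (simp add: ln_mult ln_powr ln_div)
qed

text \<open>
  With \<open>n\<close> the norm and \<open>d = ln n - ln b\<close>, the exponent is \<open>n - b + (1 / \<alpha> - 1) * d\<close>,
  and \<open>n - b \<le> n * d\<close>.  It therefore lies between two multiples of \<open>d\<close>, by
  \<open>1 / \<alpha> - 1\<close> and \<open>n + (1 / \<alpha> - 1)\<close>, neither of which contributes to the
  logarithmic rate; this rate is therefore that of \<open>d\<close>.
\<close>

lemma has_rates_cond_exponent:
  assumes \<alpha>: "0 < \<alpha>" "\<alpha> < 1" and f: "has_rates f a la" and h: "has_rates h b lb"
  shows "has_rates (\<lambda>t. cond_exponent \<alpha> (f t) (h t))
           (lnorm \<alpha> a b - b + (1 / \<alpha> - 1) * (max la lb - lb)) (min 0 ((la - lb) / \<alpha>))"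
proof -
  define n where "n = (\<lambda>t. lnorm \<alpha> (f t) (h t))"
  define d where "d = (\<lambda>t. ln (n t) - ln (h t))"
  define p where "p = 1 / \<alpha> - 1"
  have p: "0 < p" using \<alpha> by (simp add: p_def)
  have pos: "\<forall>\<^sub>F t in at_top. 0 < f t \<and> 0 < h t \<and> 0 < t"
    using f h eventually_gt_at_top[of 0] unfolding has_rates_def
    by (auto simp: eventually_conj_iff)
  have fa: "((\<lambda>t. f t / t) \<longlongrightarrow> a) at_top" and fl: "((\<lambda>t. ln (f t) / t) \<longlongrightarrow> la) at_top"
    and hb: "((\<lambda>t. h t / t) \<longlongrightarrow> b) at_top" and hl: "((\<lambda>t. ln (h t) / t) \<longlongrightarrow> lb) at_top"
    using f h by (auto simp: has_rates_def)
  have nr: "((\<lambda>t. n t / t) \<longlongrightarrow> lnorm \<alpha> a b) at_top"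
    and nl: "((\<lambda>t. ln (n t) / t) \<longlongrightarrow> max la lb) at_top"
    using has_rates_lnorm[OF \<alpha> f h] by (auto simp: has_rates_def n_def)
  have dr: "((\<lambda>t. d t / t) \<longlongrightarrow> max la lb - lb) at_top"
    using tendsto_diff[OF nl hl] by (simp add: d_def diff_divide_distrib)
  have npos: "\<forall>\<^sub>F t in at_top. 0 < n t"
    using pos by (auto simp: n_def lnorm_pos elim: eventually_mono)
  have dpos: "\<forall>\<^sub>F t in at_top. 0 < d t"
    using pos by eventually_elim (use \<alpha> ln_lnorm_ratio_bounds(1) in \<open>simp add: n_def d_def\<close>)
  have dl: "((\<lambda>t. ln (d t) / t) \<longlongrightarrow> min 0 ((la - lb) / \<alpha>)) at_top"
  proof (rule tendsto_sandwich)
    have "((\<lambda>t. ln \<alpha> / t + (ln (f t) / t - ln (n t) / t) / \<alpha>) \<longlongrightarrow> 0 + (la - max la lb) / \<alpha>) at_top"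
      using \<alpha> by (intro tendsto_intros const_over_tendsto_0 fl nl) auto
    moreover have "0 + (la - max la lb) / \<alpha> = min 0 ((la - lb) / \<alpha>)"
      using \<alpha> by (auto simp: max_def min_def field_simps)
    ultimately show "((\<lambda>t. ln \<alpha> / t + (ln (f t) / t - ln (n t) / t) / \<alpha>)
        \<longlongrightarrow> min 0 ((la - lb) / \<alpha>)) at_top" by simp
    \<comment> \<open>The bound \<open>d t < d t + 1\<close> covers the regime where \<open>d\<close> does not decay; the other one is exact where it does.\<close>
    have "((\<lambda>t. min (ln (d t + 1) / t) (ln \<alpha> / t + (ln (f t) / t - ln (h t) / t) / \<alpha>))
        \<longlongrightarrow> min 0 (0 + (la - lb) / \<alpha>)) at_top"
      using \<alpha>
      by (intro tendsto_min tendsto_intros const_over_tendsto_0 fl hl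
            ln_shift_over_tendsto_0[OF dpos dr]) auto
    then show "((\<lambda>t. min (ln (d t + 1) / t) (ln \<alpha> / t + (ln (f t) / t - ln (h t) / t) / \<alpha>))
        \<longlongrightarrow> min 0 ((la - lb) / \<alpha>)) at_top" by simp
    show "\<forall>\<^sub>F t in at_top. ln \<alpha> / t + (ln (f t) / t - ln (n t) / t) / \<alpha> \<le> ln (d t) / t"
      using pos
    proof eventually_elim
      case (elim t)
      then have "(ln \<alpha> + (ln (f t) - ln (n t)) / \<alpha>) / t \<le> ln (d t) / t"
        using ln_lnorm_ratio_bounds(2)[of \<alpha> "f t" "h t"] \<alpha>
        by (intro divide_right_mono) (auto simp: d_def n_def)
      then show ?case by (simp add: add_divide_distrib diff_divide_distrib mult.commute)
    qed
    show "\<forall>\<^sub>F t in at_top. ln (d t) / t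
        \<le> min (ln (d t + 1) / t) (ln \<alpha> / t + (ln (f t) / t - ln (h t) / t) / \<alpha>)"
      using pos dpos
    proof eventually_elim
      case (elim t)
      then have "ln (d t) / t \<le> (ln \<alpha> + (ln (f t) - ln (h t)) / \<alpha>) / t"
        using ln_lnorm_ratio_bounds(3)[of \<alpha> "f t" "h t"] \<alpha>
        by (intro divide_right_mono) (auto simp: d_def n_def)
      moreover have "ln (d t) / t \<le> ln (d t + 1) / t"
        using elim by (intro divide_right_mono) auto
      ultimately show ?case by (simp add: add_divide_distrib diff_divide_distrib mult.commute)
    qed
  qed
  have z: "cond_exponent \<alpha> (f t) (h t) = n t - h t + p * d t" for t
    by (simp add: cond_exponent_def n_def d_def p_def)
  have "((\<lambda>t. n t / t - h t / t + p * (d t / t))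
      \<longlongrightarrow> lnorm \<alpha> a b - b + p * (max la lb - lb)) at_top"
    by (intro tendsto_intros nr hb dr)
  then have 1: "((\<lambda>t. cond_exponent \<alpha> (f t) (h t) / t)
      \<longlongrightarrow> lnorm \<alpha> a b - b + p * (max la lb - lb)) at_top"
    by (simp add: z add_divide_distrib diff_divide_distrib)
  have "((\<lambda>t. ln (cond_exponent \<alpha> (f t) (h t)) / t) \<longlongrightarrow> min 0 ((la - lb) / \<alpha>)) at_top"
  proof (rule tendsto_sandwich)
    show "((\<lambda>t. ln p / t + ln (d t) / t) \<longlongrightarrow> min 0 ((la - lb) / \<alpha>)) at_top"
      using tendsto_add[OF const_over_tendsto_0[of "ln p"] dl] by simp
    show "((\<lambda>t. ln (n t + p) / t + ln (d t) / t) \<longlongrightarrow> min 0 ((la - lb) / \<alpha>)) at_top"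
      using tendsto_add[OF ln_shift_over_tendsto_0[OF npos nr p] dl] by simp
    show "\<forall>\<^sub>F t in at_top. ln p / t + ln (d t) / t \<le> ln (cond_exponent \<alpha> (f t) (h t)) / t"
      using pos dpos
    proof eventually_elim
      case (elim t)
      have "h t < n t" using elim \<alpha> lnorm_gt by (simp add: n_def)
      then have "ln (p * d t) \<le> ln (cond_exponent \<alpha> (f t) (h t))"
        unfolding z using elim p by (subst ln_le_cancel_iff) (auto simp: add_pos_pos)
      then have "ln (p * d t) / t \<le> ln (cond_exponent \<alpha> (f t) (h t)) / t"
        using elim by (intro divide_right_mono) auto
      then show ?case using elim p by (simp add: ln_mult add_divide_distrib)
    qed
    show "\<forall>\<^sub>F t in at_top. ln (cond_exponent \<alpha> (f t) (h t)) / t \<le> ln (n t + p) / t + ln (d t) / t"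
      using pos dpos npos
    proof eventually_elim
      case (elim t)
      have "ln (h t / n t) \<le> h t / n t - 1" using elim by (intro ln_le_minus_one) auto
      then have "1 - h t / n t \<le> d t" using elim by (simp add: d_def ln_div)
      then have "n t * (1 - h t / n t) \<le> n t * d t" using elim by (intro mult_left_mono) auto
      then have "n t - h t \<le> n t * d t" using elim by (simp add: right_diff_distrib)
      then have "cond_exponent \<alpha> (f t) (h t) \<le> (n t + p) * d t"
        by (simp add: z algebra_simps)
      moreover have "0 < cond_exponent \<alpha> (f t) (h t)"
        using elim \<alpha> by (intro cond_exponent_pos) auto
      ultimately have "ln (cond_exponent \<alpha> (f t) (h t)) \<le> ln ((n t + p) * d t)"
        by (subst ln_le_cancel_iff) auto
      then have "ln (cond_exponent \<alpha> (f t) (h t)) / t \<le> ln ((n t + p) * d t) / t"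
        using elim by (intro divide_right_mono) auto
      then show ?case using elim p by (simp add: ln_mult add_divide_distrib)
    qed
  qed
  with 1 pos show ?thesis
    by (auto simp: has_rates_def p_def \<alpha> cond_exponent_pos elim: eventually_mono)
qed

lemma log_density_rate:
  assumes \<alpha>: "0 < \<alpha>" "\<alpha> < 1" and f: "has_rates f a la" and h: "has_rates h b lb"
  shows "((\<lambda>t. log_density \<alpha> (f t) (h t) / t) \<longlongrightarrow>
    a + b - lnorm \<alpha> a b + (1 / \<alpha> - 1) * (la + lb) + (1 - 2 / \<alpha>) * max la lb) at_top"
proof -
  define n where "n = (\<lambda>t. lnorm \<alpha> (f t) (h t))"
  have nr: "((\<lambda>t. n t / t) \<longlongrightarrow> lnorm \<alpha> a b) at_top"
    and nl: "((\<lambda>t. ln (n t) / t) \<longlongrightarrow> max la lb) at_top" and npos: "\<forall>\<^sub>F t in at_top. 0 < n t"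
    using has_rates_lnorm[OF \<alpha> f h] by (auto simp: has_rates_def n_def)
  have fa: "((\<lambda>t. f t / t) \<longlongrightarrow> a) at_top" and fl: "((\<lambda>t. ln (f t) / t) \<longlongrightarrow> la) at_top"
    and hb: "((\<lambda>t. h t / t) \<longlongrightarrow> b) at_top" and hl: "((\<lambda>t. ln (h t) / t) \<longlongrightarrow> lb) at_top"
    using f h by (auto simp: has_rates_def)
  have "0 < 1 / \<alpha> - 1" using \<alpha> by simp
  note sh = ln_shift_over_tendsto_0[OF npos nr this]
  have "((\<lambda>t. f t / t + h t / t - n t / t + (1 / \<alpha> - 1) * (ln (f t) / t + ln (h t) / t)
      + (1 - 2 / \<alpha>) * (ln (n t) / t) + ln (n t + (1 / \<alpha> - 1)) / t) \<longlongrightarrow>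
    a + b - lnorm \<alpha> a b + (1 / \<alpha> - 1) * (la + lb) + (1 - 2 / \<alpha>) * max la lb + 0) at_top"
    by (intro tendsto_add tendsto_diff tendsto_mult tendsto_const fa hb nr fl hl nl sh)
  moreover have "log_density \<alpha> (f t) (h t) / t = f t / t + h t / t - n t / t
      + (1 / \<alpha> - 1) * (ln (f t) / t + ln (h t) / t)
      + (1 - 2 / \<alpha>) * (ln (n t) / t) + ln (n t + (1 / \<alpha> - 1)) / t" for t
    unfolding log_density_def n_def divide_inverse by (simp add: algebra_simps)
  ultimately show ?thesis by simp
qed

section \<open>The gauge function of the vine density\<close>

text \<open>
  On the exponential scale, the conditional distribution function of the logistic pair is
  \<open>exp (- z)\<close> whereas that of the inverted pair is \<open>1 - exp (- z)\<close>.  As the third copula is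
  inverted as well, only the logistic exponent enters it through \<open>exp_dual\<close>.
\<close>

lemma vine_density_eq:
  fixes x :: "real ^ 3"
  assumes "0 < \<alpha>" "\<alpha> < 1" "0 < \<beta>" "\<beta> < 1" "0 < \<gamma>" "\<gamma> < 1" and x: "\<forall>i. 0 < x $ i"
  shows "vine_density (ev_copula (logistic_V \<alpha>)) (inverted_ev_copula (logistic_V \<beta>))
              (inverted_ev_copula (logistic_V \<gamma>)) x
    = exp (log_density \<alpha> (exp_dual (x $ 1)) (exp_dual (x $ 2)) + log_density \<beta> (x $ 2) (x $ 3)
        + log_density \<gamma>
            (exp_dual (cond_exponent \<alpha> (exp_dual (x $ 1)) (exp_dual (x $ 2))))
            (cond_exponent \<beta> (x $ 3) (x $ 2))
        - (x $ 1 + x $ 2 + x $ 3))"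
proof -
  define u where "u = (\<lambda>i. 1 - exp (- x $ i))"
  have u: "0 < u i" "u i < 1" "- ln (u i) = exp_dual (x $ i)" "- ln (1 - u i) = x $ i" for i
    using x by (auto simp: u_def exp_dual_def)
  define z12 where "z12 = cond_exponent \<alpha> (exp_dual (x $ 1)) (exp_dual (x $ 2))"
  define z23 where "z23 = cond_exponent \<beta> (x $ 3) (x $ 2)"
  have z: "0 < z12" "0 < z23"
    using assms by (auto simp: z12_def z23_def intro!: cond_exponent_pos exp_dual_pos)
  have 1: "deriv (\<lambda>t. ev_copula (logistic_V \<alpha>) (u 1) t) (u 2) = exp (- z12)"
    using DERIV_logistic_right[of \<alpha> "u 1" "u 2"] assms u by (simp add: z12_def DERIV_imp_deriv)
  have 2: "deriv (\<lambda>s. inverted_ev_copula (logistic_V \<beta>) s (u 3)) (u 2) = 1 - exp (- z23)"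
    using DERIV_inverted_right[of \<beta> "u 3" "u 2"] assms u
    by (simp add: z23_def DERIV_imp_deriv inverted_commute[of \<beta> _ "u 3"])
  have 3: "copula_density (inverted_ev_copula (logistic_V \<gamma>)) (exp (- z12)) (1 - exp (- z23))
      = exp (log_density \<gamma> (exp_dual z12) z23)"
    using inverted_density[of \<gamma> "exp (- z12)" "1 - exp (- z23)"] assms z by (simp add: exp_dual_def)
  have "vine_density (ev_copula (logistic_V \<alpha>)) (inverted_ev_copula (logistic_V \<beta>))
              (inverted_ev_copula (logistic_V \<gamma>)) x
      = exp (log_density \<alpha> (exp_dual (x $ 1)) (exp_dual (x $ 2))) * exp (log_density \<beta> (x $ 2) (x $ 3))
        * exp (log_density \<gamma> (exp_dual z12) z23) * (exp (- x $ 1) * exp (- x $ 2) * exp (- x $ 3))"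
    unfolding vine_density_def Let_def
    using 1 2 3 logistic_density[of \<alpha> "u 1" "u 2"] inverted_density[of \<beta> "u 2" "u 3"] assms u
    by (simp add: u_def)
  then show ?thesis
    by (simp add: z12_def z23_def exp_add exp_diff exp_minus field_simps)
qed

text \<open>
  One formula for both cases: for \<open>x $ 1 \<le> x $ 2\<close> the outer norm has first argument zero and
  cancels the summand \<open>x $ 2\<close>.
\<close>

lemma vine_gauge_eq:
  assumes "0 < \<alpha>" "0 < \<beta>" "0 < \<gamma>" "\<forall>i. 0 \<le> x $ i"
  shows "vine_gauge \<alpha> \<beta> \<gamma> x = (1 / \<gamma>) * (1 / \<alpha> - 1) * max (x $ 2 - x $ 1) 0 + x $ 2
     + lnorm \<gamma> (max (x $ 1 - x $ 2) 0 / \<alpha>) (lnorm \<beta> (x $ 2) (x $ 3) - x $ 2)"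
proof -
  have "x $ 2 \<le> lnorm \<beta> (x $ 2) (x $ 3)"
    using assms by (simp add: lnorm_ge_left)
  then show ?thesis using assms
    by (auto simp: vine_gauge_def lnorm_def[symmetric] lnorm_zero max_def)
qed

lemma continuous_on_vine_gauge:
  assumes "0 < \<alpha>" "0 < \<beta>" "0 < \<gamma>"
  shows "continuous_on {x. \<forall>i. 0 \<le> x $ i} (vine_gauge \<alpha> \<beta> \<gamma>)"
proof (rule continuous_on_eq)
  show "continuous_on {x. \<forall>i. 0 \<le> x $ i}
    (\<lambda>x::real^3. (1 / \<gamma>) * (1 / \<alpha> - 1) * max (x $ 2 - x $ 1) 0 + x $ 2
     + lnorm \<gamma> (max (x $ 1 - x $ 2) 0 / \<alpha>) (lnorm \<beta> (x $ 2) (x $ 3) - x $ 2))"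
    using assms by (intro continuous_intros) (auto simp: lnorm_ge_left)
qed (use assms vine_gauge_eq in auto)

lemma vine_gauge_homogeneous:
  assumes "0 < \<alpha>" "0 < \<beta>" "0 < \<gamma>" "\<forall>i. 0 \<le> x $ i" "0 \<le> t"
  shows "vine_gauge \<alpha> \<beta> \<gamma> (t *\<^sub>R x) = t * vine_gauge \<alpha> \<beta> \<gamma> x"
proof -
  have le: "x $ 2 \<le> lnorm \<beta> (x $ 2) (x $ 3)"
    using assms by (simp add: lnorm_ge_left)
  have mx: "max (t * y - t * z) 0 = t * max (y - z) 0" for y z
    using assms by (simp add: max_mult_distrib_left right_diff_distrib)
  have 1: "lnorm \<beta> (t * x $ 2) (t * x $ 3) = t * lnorm \<beta> (x $ 2) (x $ 3)"
    using assms by (intro lnorm_scale) auto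
  have "lnorm \<gamma> (t * (max (x $ 1 - x $ 2) 0 / \<alpha>)) (t * (lnorm \<beta> (x $ 2) (x $ 3) - x $ 2))
      = t * lnorm \<gamma> (max (x $ 1 - x $ 2) 0 / \<alpha>) (lnorm \<beta> (x $ 2) (x $ 3) - x $ 2)"
    using assms le by (intro lnorm_scale) auto
  then show ?thesis using assms
    by (simp add: vine_gauge_eq mx 1 right_diff_distrib distrib_left mult.left_commute)
qed

lemma vine_density_rate:
  fixes x :: "real ^ 3"
  assumes \<alpha>: "0 < \<alpha>" "\<alpha> < 1" and \<beta>: "0 < \<beta>" "\<beta> < 1" and \<gamma>: "0 < \<gamma>" "\<gamma> < 1"
    and x: "\<forall>i. 0 < x $ i"
  defines "f \<equiv> vine_density (ev_copula (logistic_V \<alpha>)) (inverted_ev_copula (logistic_V \<beta>))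
              (inverted_ev_copula (logistic_V \<gamma>))"
  shows "((\<lambda>t. - ln (f (t *\<^sub>R x)) / t) \<longlongrightarrow> vine_gauge \<alpha> \<beta> \<gamma> x) at_top"
proof -
  define x1 x2 x3 where "x1 = x $ 1" and "x2 = x $ 2" and "x3 = x $ 3"
  have pos: "0 < x1" "0 < x2" "0 < x3" using x by (auto simp: x1_def x2_def x3_def)
  define W where "W = lnorm \<beta> x2 x3"
  \<comment> \<open>Splitting \<open>x1 - x2 = dm - dp\<close> into its parts avoids distinguishing the two cases of the gauge function.\<close>
  define dp dm where "dp = max (x2 - x1) 0" and "dm = max (x1 - x2) 0"
  have lin: "has_rates (\<lambda>t. t * x1) x1 0" "has_rates (\<lambda>t. t * x2) x2 0" "has_rates (\<lambda>t. t * x3) x3 0"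
    using pos by (auto intro: has_rates_linear)
  have a: "has_rates (\<lambda>t. exp_dual (t * x1)) 0 (- x1)" and b: "has_rates (\<lambda>t. exp_dual (t * x2)) 0 (- x2)"
    using has_rates_exp_dual[OF lin(1)] has_rates_exp_dual[OF lin(2)] by simp_all
  have max12: "max (- x1) (- x2) = dp - x2" and min12: "min 0 ((- x1 - - x2) / \<alpha>) = - (dm / \<alpha>)"
    using \<alpha> by (auto simp: dp_def dm_def max_def min_def field_simps)
  have "has_rates (\<lambda>t. cond_exponent \<alpha> (exp_dual (t * x1)) (exp_dual (t * x2)))
      ((1 / \<alpha> - 1) * dp) (- (dm / \<alpha>))"
    using has_rates_cond_exponent[OF \<alpha> a b] lnorm_zero[of \<alpha> 0] \<alpha> unfolding max12 min12 by simp
  from has_rates_exp_dual[OF this]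
  have A: "has_rates (\<lambda>t. exp_dual (cond_exponent \<alpha> (exp_dual (t * x1)) (exp_dual (t * x2))))
      (dm / \<alpha>) (- ((1 / \<alpha> - 1) * dp))" by simp
  have B: "has_rates (\<lambda>t. cond_exponent \<beta> (t * x3) (t * x2)) (W - x2) 0"
    using has_rates_cond_exponent[OF \<beta> lin(3) lin(2)] by (simp add: W_def lnorm_commute)
  have L12: "((\<lambda>t. log_density \<alpha> (exp_dual (t * x1)) (exp_dual (t * x2)) / t) \<longlongrightarrow>
      (1 / \<alpha> - 1) * (- x1 - x2) + (1 - 2 / \<alpha>) * (dp - x2)) at_top"
    using log_density_rate[OF \<alpha> a b] lnorm_zero[of \<alpha> 0] \<alpha> unfolding max12 by simp
  have L23: "((\<lambda>t. log_density \<beta> (t * x2) (t * x3) / t) \<longlongrightarrow> x2 + x3 - W) at_top"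
    using log_density_rate[OF \<beta> lin(2) lin(3)] by (simp add: W_def)
  have "0 \<le> (1 / \<alpha> - 1) * dp" using \<alpha> by (intro mult_nonneg_nonneg) (auto simp: dp_def)
  then have max0: "max (- ((1 / \<alpha> - 1) * dp)) 0 = 0" by simp
  have L13: "((\<lambda>t. log_density \<gamma> (exp_dual (cond_exponent \<alpha> (exp_dual (t * x1)) (exp_dual (t * x2))))
        (cond_exponent \<beta> (t * x3) (t * x2)) / t) \<longlongrightarrow>
      dm / \<alpha> + (W - x2) - lnorm \<gamma> (dm / \<alpha>) (W - x2) - (1 / \<gamma> - 1) * ((1 / \<alpha> - 1) * dp)) at_top"
    using log_density_rate[OF \<gamma> A B] unfolding max0 by simp
  have "((\<lambda>t. (x1 + x2 + x3)
        - log_density \<alpha> (exp_dual (t * x1)) (exp_dual (t * x2)) / t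
        - log_density \<beta> (t * x2) (t * x3) / t
        - log_density \<gamma> (exp_dual (cond_exponent \<alpha> (exp_dual (t * x1)) (exp_dual (t * x2))))
            (cond_exponent \<beta> (t * x3) (t * x2)) / t) \<longlongrightarrow>
      (x1 + x2 + x3) - ((1 / \<alpha> - 1) * (- x1 - x2) + (1 - 2 / \<alpha>) * (dp - x2)) - (x2 + x3 - W)
      - (dm / \<alpha> + (W - x2) - lnorm \<gamma> (dm / \<alpha>) (W - x2) - (1 / \<gamma> - 1) * ((1 / \<alpha> - 1) * dp))) at_top"
    by (intro tendsto_diff tendsto_const L12 L23 L13)
  also have "(x1 + x2 + x3) - ((1 / \<alpha> - 1) * (- x1 - x2) + (1 - 2 / \<alpha>) * (dp - x2)) - (x2 + x3 - W)
      - (dm / \<alpha> + (W - x2) - lnorm \<gamma> (dm / \<alpha>) (W - x2) - (1 / \<gamma> - 1) * ((1 / \<alpha> - 1) * dp))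
      = vine_gauge \<alpha> \<beta> \<gamma> x"
  proof -
    have x1: "x1 = x2 + dm - dp" by (simp add: dp_def dm_def max_def)
    have "vine_gauge \<alpha> \<beta> \<gamma> x = (1 / \<gamma>) * (1 / \<alpha> - 1) * dp + x2 + lnorm \<gamma> (dm / \<alpha>) (W - x2)"
      using vine_gauge_eq[of \<alpha> \<beta> \<gamma> x] assms
      by (simp add: dp_def dm_def W_def x1_def x2_def x3_def less_imp_le)
    then show ?thesis
      unfolding x1 divide_inverse by (simp add: algebra_simps)
  qed
  finally show ?thesis
  proof (rule Lim_transform_eventually)
    show "\<forall>\<^sub>F t in at_top. (x1 + x2 + x3)
        - log_density \<alpha> (exp_dual (t * x1)) (exp_dual (t * x2)) / t
        - log_density \<beta> (t * x2) (t * x3) / t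
        - log_density \<gamma> (exp_dual (cond_exponent \<alpha> (exp_dual (t * x1)) (exp_dual (t * x2))))
            (cond_exponent \<beta> (t * x3) (t * x2)) / t = - ln (f (t *\<^sub>R x)) / t"
      using eventually_gt_at_top[of 0]
    proof eventually_elim
      case (elim t)
      then have "ln (f (t *\<^sub>R x)) = log_density \<alpha> (exp_dual (t * x1)) (exp_dual (t * x2))
        + log_density \<beta> (t * x2) (t * x3)
        + log_density \<gamma> (exp_dual (cond_exponent \<alpha> (exp_dual (t * x1)) (exp_dual (t * x2))))
            (cond_exponent \<beta> (t * x3) (t * x2)) - (t * x1 + t * x2 + t * x3)"
        unfolding f_def using x by (subst vine_density_eq) (auto simp: \<alpha> \<beta> \<gamma> x1_def x2_def x3_def)
      then show ?case using elim by (simp add: diff_divide_distrib add_divide_distrib)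
    qed
  qed
qed

lemma vine_gauge_is_gauge_function:
  assumes "0 < \<alpha>" "\<alpha> < 1" "0 < \<beta>" "\<beta> < 1" "0 < \<gamma>" "\<gamma> < 1"
  shows "is_gauge_function (vine_density (ev_copula (logistic_V \<alpha>)) (inverted_ev_copula (logistic_V \<beta>))
              (inverted_ev_copula (logistic_V \<gamma>))) (vine_gauge \<alpha> \<beta> \<gamma>)"
  unfolding is_gauge_function_def
proof (intro conjI allI impI)
  fix x :: "real ^ 3" assume x: "\<forall>i. 0 < x $ i"
  let ?f = "vine_density (ev_copula (logistic_V \<alpha>)) (inverted_ev_copula (logistic_V \<beta>))
              (inverted_ev_copula (logistic_V \<gamma>))"
  have g: "0 < vine_gauge \<alpha> \<beta> \<gamma> x"
  proof -
    have "0 \<le> (1 / \<gamma>) * (1 / \<alpha> - 1) * max (x $ 2 - x $ 1) 0"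
      using assms by (intro mult_nonneg_nonneg) auto
    moreover have "0 \<le> lnorm \<gamma> (max (x $ 1 - x $ 2) 0 / \<alpha>) (lnorm \<beta> (x $ 2) (x $ 3) - x $ 2)"
      by (simp add: lnorm_def)
    moreover have "0 < x $ 2" using x by simp
    ultimately have "0 < (1 / \<gamma>) * (1 / \<alpha> - 1) * max (x $ 2 - x $ 1) 0 + x $ 2
        + lnorm \<gamma> (max (x $ 1 - x $ 2) 0 / \<alpha>) (lnorm \<beta> (x $ 2) (x $ 3) - x $ 2)" by linarith
    then show ?thesis using x assms by (subst vine_gauge_eq) (auto intro: less_imp_le)
  qed
  show "(\<lambda>t. - ln (?f (t *\<^sub>R x))) \<sim>[at_top] (\<lambda>t. t * vine_gauge \<alpha> \<beta> \<gamma> x)"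
  proof (rule asymp_equivI')
    show "((\<lambda>t. - ln (?f (t *\<^sub>R x)) / (t * vine_gauge \<alpha> \<beta> \<gamma> x)) \<longlongrightarrow> 1) at_top"
      using tendsto_divide[OF vine_density_rate[OF assms x] tendsto_const[of "vine_gauge \<alpha> \<beta> \<gamma> x"]] g
      by simp
  qed
qed (use assms continuous_on_vine_gauge vine_gauge_homogeneous in auto)

section \<open>Supporting hyperplanes of the norm\<close>

text \<open>
  Bernoulli's inequality for real exponents, strict away from the point of tangency; a mean value
  argument on either side of \<open>1\<close>.
\<close>

lemma powr_tangent_strict:
  fixes x p :: real
  assumes "0 \<le> x" "x \<noteq> 1" "1 < p"
  shows "1 + p * (x - 1) < x powr p"
proof (cases "x = 0 \<or> 1 < x")
  case True
  then consider "x = 0" | "1 < x" by blast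
  then show ?thesis
  proof cases
    case 1 then show ?thesis using assms by simp
  next
    case 2
    have "\<exists>z. 1 < z \<and> z < x \<and> x powr p - 1 powr p = (x - 1) * (p * z powr (p - 1))"
      using 2 by (intro MVT2) (auto intro!: derivative_eq_intros)
    then obtain z where z: "1 < z" "x powr p - 1 = (x - 1) * (p * z powr (p - 1))" by auto
    have "1 < z powr (p - 1)" using z assms by simp
    then have "(x - 1) * (p * 1) < (x - 1) * (p * z powr (p - 1))"
      using 2 assms by (intro mult_strict_left_mono) auto
    then show ?thesis using z by (simp add: algebra_simps)
  qed
next
  case False
  then have x: "0 < x" "x < 1" using assms by auto
  have "\<exists>z. x < z \<and> z < 1 \<and> 1 powr p - x powr p = (1 - x) * (p * z powr (p - 1))"
    using x by (intro MVT2) (auto intro!: derivative_eq_intros)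
  then obtain z where z: "x < z" "z < 1" "1 - x powr p = (1 - x) * (p * z powr (p - 1))" by auto
  have "z powr (p - 1) < 1" using z x assms powr_less_mono2[of "p - 1" z 1] by simp
  then have "(1 - x) * (p * z powr (p - 1)) < (1 - x) * (p * 1)"
    using x assms by (intro mult_strict_left_mono) auto
  then show ?thesis using z by (simp add: algebra_simps)
qed

lemma powr_tangent: "0 \<le> x \<Longrightarrow> 1 < p \<Longrightarrow> 1 + p * (x - 1) \<le> x powr p" for x p :: real
  using powr_tangent_strict[of x p] by (cases "x = 1") auto

text \<open>
  Euler's identity for a function homogeneous of degree one: the supporting hyperplane at \<open>(A, B)\<close>
  touches the graph at \<open>(A, B)\<close> itself.
\<close>

lemma lnorm_euler:
  assumes "0 < \<alpha>" "0 \<le> A" "0 < B"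
  defines "n \<equiv> lnorm \<alpha> A B"
  shows "A * (A / n) powr (1 / \<alpha> - 1) + B * (B / n) powr (1 / \<alpha> - 1) = n"
proof -
  have n: "0 < n" using assms lnorm_pos[of B \<alpha> A] by (simp add: n_def lnorm_commute)
  have e: "x * (x / n) powr (1 / \<alpha> - 1) = n * (x powr (1 / \<alpha>) / n powr (1 / \<alpha>))" if "0 \<le> x" for x
    using that n by (cases "x = 0") (auto simp: powr_divide powr_diff)
  have "n powr (1 / \<alpha>) = A powr (1 / \<alpha>) + B powr (1 / \<alpha>)"
    using assms by (simp add: n_def lnorm_powr)
  moreover have "0 < n powr (1 / \<alpha>)" using n by simp
  ultimately show ?thesis using assms e[of A] e[of B]
    by (simp add: distrib_left[symmetric] add_divide_distrib[symmetric])
qed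

text \<open>
  The graph of the norm lies above its supporting hyperplane at \<open>(A, B)\<close> (Hoelder's inequality), and
  touches it only on the ray through that point.  Normalised by the value \<open>M\<close> of the hyperplane, the
  powers of \<open>a\<close> and \<open>b\<close> become a convex combination of \<open>x powr p\<close> and
  \<open>y powr p\<close> in which \<open>x\<close> and \<open>y\<close> have mean \<open>1\<close>, so the tangents of
  \<open>x \<mapsto> x powr p\<close> at \<open>1\<close> suffice.
\<close>

lemma lnorm_tangent:
  assumes "0 < \<alpha>" "\<alpha> < 1" "0 < A" "0 < B" "0 \<le> a" "0 \<le> b"
  defines "n \<equiv> lnorm \<alpha> A B"
  defines "M \<equiv> a * (A / n) powr (1 / \<alpha> - 1) + b * (B / n) powr (1 / \<alpha> - 1)"
  shows "M \<le> lnorm \<alpha> a b" "a * B \<noteq> b * A \<Longrightarrow> M < lnorm \<alpha> a b"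
proof -
  define p where "p = 1 / \<alpha>"
  have p: "1 < p" using assms by (simp add: p_def)
  have n: "0 < n" using assms lnorm_pos by (simp add: n_def)
  have g: "0 < (A / n) powr (p - 1)" "0 < (B / n) powr (p - 1)" using assms n by auto
  have M: "M = a * (A / n) powr (p - 1) + b * (B / n) powr (p - 1)" by (simp add: M_def p_def)
  have "M \<le> lnorm \<alpha> a b \<and> (a * B \<noteq> b * A \<longrightarrow> M < lnorm \<alpha> a b)"
  proof (cases "a = 0 \<and> b = 0")
    case True
    then show ?thesis using assms lnorm_zero[of \<alpha> 0] by (simp add: M)
  next
    case False
    then have Mpos: "0 < M" unfolding M
      using g assms by (metis add_nonneg_pos add_pos_nonneg less_eq_real_def mult_nonneg_nonneg mult_pos_pos)
    define l m x y where "l = (A / n) powr p" and "m = (B / n) powr p"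
      and "x = a * n / (A * M)" and "y = b * n / (B * M)"
    have xy: "0 \<le> x" "0 \<le> y" using assms n Mpos by (auto simp: x_def y_def)
    have lm: "0 < l" "0 < m" using assms n by (auto simp: l_def m_def)
    have "n powr p = A powr p + B powr p" using assms by (simp add: n_def p_def lnorm_powr)
    moreover have "0 < n powr p" using n by simp
    ultimately have s1: "l + m = 1"
      using assms n by (simp add: l_def m_def powr_divide add_divide_distrib[symmetric])
    have l': "l = (A / n) powr (p - 1) * (A / n)" and m': "m = (B / n) powr (p - 1) * (B / n)"
      using assms n by (auto simp: l_def m_def powr_diff)
    have "l * x = a * (A / n) powr (p - 1) / M" "m * y = b * (B / n) powr (p - 1) / M"
      using assms n Mpos by (auto simp: l' m' x_def y_def)
    then have s2: "l * x + m * y = 1" using Mpos by (simp add: add_divide_distrib[symmetric] M[symmetric])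
    have "l * x powr p = (A / n * x) powr p" "m * y powr p = (B / n * y) powr p"
      using powr_mult[of "A / n" x p] powr_mult[of "B / n" y p] assms(3,4) n xy
      by (auto simp: l_def m_def)
    moreover have "A / n * x = a / M" "B / n * y = b / M"
      using assms n Mpos by (auto simp: x_def y_def)
    ultimately have "l * x powr p + m * y powr p = (a / M) powr p + (b / M) powr p" by simp
    then have s3: "l * x powr p + m * y powr p = (a powr p + b powr p) / M powr p"
      using assms(5,6) Mpos by (simp add: powr_divide add_divide_distrib)
    \<comment> \<open>The tangent lines average to \<open>1\<close>, since the weights and the weighted mean of \<open>x\<close> and \<open>y\<close> are \<open>1\<close>.\<close>
    have s4: "l * (1 + p * (x - 1)) + m * (1 + p * (y - 1)) = 1"
      using s1 s2 by algebra
    have tx: "l * (1 + p * (x - 1)) \<le> l * x powr p" "x \<noteq> 1 \<Longrightarrow> l * (1 + p * (x - 1)) < l * x powr p"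
      using powr_tangent[OF xy(1) p] powr_tangent_strict[OF xy(1) _ p] lm by auto
    have ty: "m * (1 + p * (y - 1)) \<le> m * y powr p" "y \<noteq> 1 \<Longrightarrow> m * (1 + p * (y - 1)) < m * y powr p"
      using powr_tangent[OF xy(2) p] powr_tangent_strict[OF xy(2) _ p] lm by auto
    have fin: "(M powr p) powr \<alpha> = M" "lnorm \<alpha> a b = (a powr p + b powr p) powr \<alpha>"
      using Mpos assms by (auto simp: p_def powr_powr lnorm_def)
    have "1 \<le> (a powr p + b powr p) / M powr p" using s3 s4 tx ty by linarith
    then have "M powr p \<le> a powr p + b powr p" using Mpos by simp
    then have "(M powr p) powr \<alpha> \<le> (a powr p + b powr p) powr \<alpha>"
      using assms by (intro powr_mono2) auto
    moreover have "M < lnorm \<alpha> a b" if ne: "a * B \<noteq> b * A"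
    proof -
      have "x \<noteq> 1 \<or> y \<noteq> 1"
      proof (rule ccontr)
        assume "\<not> ?thesis"
        then have "a * n = A * M" "b * n = B * M" using assms n Mpos by (auto simp: x_def y_def)
        then have "(a * B - b * A) * n = 0" by algebra
        with n ne show False by simp
      qed
      then have "1 < (a powr p + b powr p) / M powr p" using s3 s4 tx ty by linarith
      then have "M powr p < a powr p + b powr p" using Mpos by simp
      then have "(M powr p) powr \<alpha> < (a powr p + b powr p) powr \<alpha>"
        using assms by (intro powr_less_mono2) auto
      then show ?thesis using fin by simp
    qed
    ultimately show ?thesis using fin by simp
  qed
  then show "M \<le> lnorm \<alpha> a b" "a * B \<noteq> b * A \<Longrightarrow> M < lnorm \<alpha> a b" by auto
qed

section \<open>Minimising the gauge function\<close>

text \<open>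
  The gauge function at \<open>(1, v, 1)\<close>, for \<open>0 \<le> v \<le> 1\<close>.
\<close>

definition profile :: "real \<Rightarrow> real \<Rightarrow> real \<Rightarrow> real \<Rightarrow> real" where
  "profile \<alpha> \<beta> \<gamma> v = v + lnorm \<gamma> ((1 - v) / \<alpha>) (lnorm \<beta> 1 v - v)"

text \<open>
  The derivative of the profile, written with the gradients of the two norms.  Unlike the
  stationarity equation, whose term \<open>v powr (- 1 / \<beta>)\<close> evaluates to \<open>0\<close> at
  \<open>v = 0\<close>, this form is continuous on the closed unit interval.
\<close>

definition slope :: "real \<Rightarrow> real \<Rightarrow> real \<Rightarrow> real \<Rightarrow> real" where
  "slope \<alpha> \<beta> \<gamma> v =
    (let m = lnorm \<beta> 1 v; a = (1 - v) / \<alpha>; b = m - v; n = lnorm \<gamma> a b in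
     1 - (1 / \<alpha>) * (a / n) powr (1 / \<gamma> - 1)
       + (b / n) powr (1 / \<gamma> - 1) * ((v / m) powr (1 / \<beta> - 1) - 1))"

text \<open>
  Two supporting hyperplanes are combined.  For the inner norm the inequality is strict, because
  \<open>(1, w)\<close> and \<open>(1, v)\<close> are not proportional, and strictness survives since the outer norm has
  positive partial derivative in its second argument.
\<close>

lemma profile_tangent:
  assumes pars: "0 < \<alpha>" "0 < \<beta>" "\<beta> < 1" "0 < \<gamma>" "\<gamma> < 1"
    and "0 < v" "v < 1" "0 \<le> w" "w \<le> 1" "w \<noteq> v"
  shows "profile \<alpha> \<beta> \<gamma> v + slope \<alpha> \<beta> \<gamma> v * (w - v) < profile \<alpha> \<beta> \<gamma> w"
proof -
  define m a b n where "m = lnorm \<beta> 1 v" and "a = (1 - v) / \<alpha>" and "b = m - v" and "n = lnorm \<gamma> a b"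
  define a' b' where "a' = (1 - w) / \<alpha>" and "b' = lnorm \<beta> 1 w - w"
  define ga gb \<mu> where "ga = (a / n) powr (1 / \<gamma> - 1)" and "gb = (b / n) powr (1 / \<gamma> - 1)"
    and "\<mu> = (v / m) powr (1 / \<beta> - 1)"
  have pos: "0 < a" "0 < b" "0 \<le> a'" "0 \<le> b'"
    using assms lnorm_gt[of \<beta> 1 v] lnorm_gt[of \<beta> 1 w]
    by (auto simp: a_def b_def a'_def b'_def m_def)
  then have n: "0 < n" using lnorm_pos by (simp add: n_def)
  then have gb: "0 < gb" using pos by (simp add: gb_def)
  have "(1 / m) powr (1 / \<beta> - 1) + w * \<mu> < lnorm \<beta> 1 w"
    using lnorm_tangent(2)[of \<beta> 1 v 1 w] assms by (simp add: m_def \<mu>_def)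
  moreover have "(1 / m) powr (1 / \<beta> - 1) + v * \<mu> = m"
    using lnorm_euler[of \<beta> 1 v] assms by (simp add: m_def \<mu>_def)
  ultimately have "b + (\<mu> - 1) * (w - v) < b'" by (simp add: b_def b'_def algebra_simps)
  then have "(b + (\<mu> - 1) * (w - v)) * gb < b' * gb" using gb by (rule mult_strict_right_mono)
  moreover have "a' * ga + b' * gb \<le> lnorm \<gamma> a' b'"
    using lnorm_tangent(1)[of \<gamma> a b a' b'] assms pos by (simp add: ga_def gb_def n_def)
  moreover have n_eq: "n = a * ga + b * gb"
    using lnorm_euler[of \<gamma> a b] assms pos by (simp add: ga_def gb_def n_def)
  moreover have a'_eq: "a' = a - (1 / \<alpha>) * (w - v)" by (simp add: a_def a'_def diff_divide_distrib)
  moreover have slope: "slope \<alpha> \<beta> \<gamma> v = 1 - (1 / \<alpha>) * ga + gb * (\<mu> - 1)"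
    by (simp add: slope_def Let_def ga_def gb_def \<mu>_def n_def m_def[symmetric] a_def[symmetric] b_def[symmetric])
  moreover have "profile \<alpha> \<beta> \<gamma> v = v + n" "profile \<alpha> \<beta> \<gamma> w = w + lnorm \<gamma> a' b'"
    by (auto simp: profile_def n_def a_def b_def m_def a'_def b'_def)
  moreover have "v + n + slope \<alpha> \<beta> \<gamma> v * (w - v)
      = w + a' * ga + (b + (\<mu> - 1) * (w - v)) * gb"
    unfolding n_eq a'_eq slope by (simp add: algebra_simps)
  ultimately show ?thesis by linarith
qed

lemma slope_eq:
  assumes "0 < \<alpha>" "0 < \<beta>" "\<beta> < 1" "0 < \<gamma>" "\<gamma> < 1" "0 < v" "v < 1"
  shows "slope \<alpha> \<beta> \<gamma> v =
    1 + (((1 - v) / \<alpha>) powr (1 / \<gamma>)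
          + ((1 + v powr (1 / \<beta>)) powr \<beta> - v) powr (1 / \<gamma>)) powr (\<gamma> - 1)
        * (- (\<alpha> powr (- 1 / \<gamma>)) * (1 - v) powr (- 1 + 1 / \<gamma>)
           + ((1 + v powr (1 / \<beta>)) powr \<beta> - v) powr (- 1 + 1 / \<gamma>)
             * ((1 + v powr (- 1 / \<beta>)) powr (\<beta> - 1) - 1))"
proof -
  define m a b n where "m = lnorm \<beta> 1 v" and "a = (1 - v) / \<alpha>" and "b = m - v" and "n = lnorm \<gamma> a b"
  define S where "S = a powr (1 / \<gamma>) + b powr (1 / \<gamma>)"
  define q where "q = 1 / \<gamma> - 1"
  have m: "(1 + v powr (1 / \<beta>)) powr \<beta> = m" by (simp add: m_def lnorm_def)
  have pos: "0 < a" "0 < b" "0 < m"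
    using assms lnorm_gt[of \<beta> 1 v] lnorm_pos[of 1 \<beta> v] by (auto simp: a_def b_def m_def)
  then have n: "0 < n" using lnorm_pos by (simp add: n_def)
  have S: "0 < S" using pos by (simp add: S_def add_pos_pos)
  have ng: "(x / n) powr q = S powr (\<gamma> - 1) * x powr q" if "0 < x" for x
  proof -
    have "n powr q = S powr (1 - \<gamma>)"
      using assms by (simp add: n_def lnorm_def S_def powr_powr q_def right_diff_distrib)
    also have "\<dots> = inverse (S powr (\<gamma> - 1))" by (metis minus_diff_eq powr_minus)
    finally have "x powr q / n powr q = S powr (\<gamma> - 1) * x powr q"
      by (simp add: divide_inverse mult.commute)
    then show ?thesis using that n by (simp add: powr_divide)
  qed
  have 1: "(1 / \<alpha>) * a powr q = \<alpha> powr (- 1 / \<gamma>) * (1 - v) powr q"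
  proof -
    have "\<alpha> powr (- 1 / \<gamma>) = inverse (\<alpha> powr (q + 1))"
      by (simp add: q_def powr_minus[symmetric])
    also have "\<dots> = inverse (\<alpha> * \<alpha> powr q)" using assms by (simp add: powr_add)
    finally show ?thesis using assms by (simp add: a_def powr_divide field_simps)
  qed
  have 2: "(1 + v powr (- 1 / \<beta>)) powr (\<beta> - 1) = (v / m) powr (1 / \<beta> - 1)"
  proof -
    have mp: "m powr (1 / \<beta>) = 1 + v powr (1 / \<beta>)"
      using assms by (simp add: m_def lnorm_powr)
    have "v powr (- 1 / \<beta>) = inverse (v powr (1 / \<beta>))" by (simp add: powr_minus[symmetric])
    then have "1 + v powr (- 1 / \<beta>) = (m / v) powr (1 / \<beta>)"
      using assms pos by (simp add: powr_divide mp field_simps)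
    then have "(1 + v powr (- 1 / \<beta>)) powr (\<beta> - 1) = (m / v) powr (- (1 / \<beta> - 1))"
      using assms by (simp add: powr_powr right_diff_distrib)
    also have "\<dots> = (v / m) powr (1 / \<beta> - 1)"
      unfolding powr_minus using assms pos by (simp add: powr_divide)
    finally show ?thesis .
  qed
  have "slope \<alpha> \<beta> \<gamma> v = 1 - (1 / \<alpha>) * (a / n) powr q + (b / n) powr q * ((v / m) powr (1 / \<beta> - 1) - 1)"
    by (simp add: slope_def Let_def q_def n_def m_def[symmetric] a_def[symmetric] b_def[symmetric])
  also have "\<dots> = 1 - S powr (\<gamma> - 1) * ((1 / \<alpha>) * a powr q)
      + S powr (\<gamma> - 1) * b powr q * ((v / m) powr (1 / \<beta> - 1) - 1)"
    using pos by (simp add: ng)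
  also have "\<dots> = 1 + S powr (\<gamma> - 1) * (- (\<alpha> powr (- 1 / \<gamma>)) * (1 - v) powr q
      + b powr q * ((1 + v powr (- 1 / \<beta>)) powr (\<beta> - 1) - 1))"
    unfolding 1 2 by (simp add: algebra_simps)
  finally show ?thesis
    unfolding m by (simp add: S_def a_def b_def q_def)
qed

lemma continuous_on_pos_powr:
  fixes f :: "'a::topological_space \<Rightarrow> real"
  assumes "0 < p" "continuous_on S f" "\<And>x. x \<in> S \<Longrightarrow> 0 \<le> f x"
  shows "continuous_on S (\<lambda>x. f x powr p)"
  using assms by (intro continuous_on_powr' continuous_on_const) auto

text \<open>
  At \<open>0\<close> the slope is \<open>1\<close> minus the outer norm of \<open>(1 / \<alpha>, 1)\<close>, by Euler's identity, and
  that norm exceeds its second argument.  At \<open>1\<close> the outer norm has first argument zero and only the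
  positive derivative of the inner norm is left.
\<close>

lemma slope_root:
  assumes "0 < \<alpha>" "\<alpha> < 1" "0 < \<beta>" "\<beta> < 1" "0 < \<gamma>" "\<gamma> < 1"
  obtains v where "0 < v" "v < 1" "slope \<alpha> \<beta> \<gamma> v = 0"
proof -
  have b: "0 < lnorm \<beta> 1 v - v" if "0 \<le> v" for v
    using that assms lnorm_gt[of \<beta> 1 v] by simp
  have n: "0 < lnorm \<gamma> ((1 - v) / \<alpha>) (lnorm \<beta> 1 v - v)" if "0 \<le> v" for v
    using b[OF that] lnorm_pos lnorm_commute by metis
  have m: "0 < lnorm \<beta> 1 v" for v by (simp add: lnorm_pos)
  have cm: "continuous_on {0..1} (lnorm \<beta> 1)"
    using assms by (intro continuous_on_lnorm continuous_intros) auto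
  have cb: "continuous_on {0..1} (\<lambda>v. lnorm \<beta> 1 v - v)"
    by (intro continuous_intros cm)
  have ca: "continuous_on {0..1} (\<lambda>v. (1 - v) / \<alpha>)"
    using assms by (intro continuous_intros) auto
  have cn: "continuous_on {0..1} (\<lambda>v. lnorm \<gamma> ((1 - v) / \<alpha>) (lnorm \<beta> 1 v - v))"
    using assms b by (intro continuous_on_lnorm ca cb) (auto intro: less_imp_le)
  have q: "0 < 1 / \<gamma> - 1" "0 < 1 / \<beta> - 1" using assms by auto
  have "continuous_on {0..1} (slope \<alpha> \<beta> \<gamma>)"
    unfolding slope_def[abs_def] Let_def
  proof (intro continuous_on_add continuous_on_diff continuous_on_mult continuous_on_const
      continuous_on_pos_powr q continuous_on_divide ca cb cn cm continuous_on_id)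
    fix v :: real assume "v \<in> {0..1}"
    then have v: "0 \<le> v" "v \<le> 1" by auto
    show "0 \<le> (1 - v) / \<alpha> / lnorm \<gamma> ((1 - v) / \<alpha>) (lnorm \<beta> 1 v - v)"
      using v n[of v] assms by (intro divide_nonneg_pos) auto
    show "0 \<le> (lnorm \<beta> 1 v - v) / lnorm \<gamma> ((1 - v) / \<alpha>) (lnorm \<beta> 1 v - v)"
      using v n[of v] b[of v] by (intro divide_nonneg_pos) auto
    show "0 \<le> v / lnorm \<beta> 1 v" using v m[of v] by (intro divide_nonneg_pos)
  qed (use n m assms in \<open>auto simp: less_imp_neq[THEN not_sym]\<close>)
  moreover have s0: "slope \<alpha> \<beta> \<gamma> 0 < 0"
  proof -
    define n where "n = lnorm \<gamma> (1 / \<alpha>) 1"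
    have "1 < n" using assms lnorm_gt[of \<gamma> "1 / \<alpha>" 1] by (simp add: n_def)
    moreover have "lnorm \<beta> 1 0 = 1" using lnorm_zero[of \<beta> 1] assms by (simp add: lnorm_commute)
    then have "slope \<alpha> \<beta> \<gamma> 0 = 1 - (1 / \<alpha> * (1 / \<alpha> / n) powr (1 / \<gamma> - 1) + 1 * (1 / n) powr (1 / \<gamma> - 1))"
      by (simp add: slope_def Let_def n_def)
    then have "slope \<alpha> \<beta> \<gamma> 0 = 1 - n"
      unfolding n_def by (subst (asm) lnorm_euler) (use assms in auto)
    ultimately show ?thesis by simp
  qed
  moreover have s1: "0 < slope \<alpha> \<beta> \<gamma> 1"
    using assms b[of 1] m[of 1] by (simp add: slope_def Let_def lnorm_zero)
  ultimately obtain v where v: "0 \<le> v" "v \<le> 1" "slope \<alpha> \<beta> \<gamma> v = 0"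
    using IVT'[of "slope \<alpha> \<beta> \<gamma>" 0 0 1] by auto
  with that[of v] s0 s1 show ?thesis by (cases "v = 0 \<or> v = 1") auto
qed

text \<open>
  If \<open>x $ 2 \<ge> 1\<close>, the gauge function dominates the inner norm of \<open>(x $ 2, x $ 3)\<close>, hence its
  value at \<open>(1, 1)\<close>, which is the profile at \<open>1\<close>.  Otherwise \<open>x $ 2 < 1 \<le> x $ 1\<close> and
  both norms are monotone, so that \<open>w = x $ 2\<close> serves.
\<close>

lemma vine_gauge_ge_profile:
  assumes pars: "0 < \<alpha>" "\<alpha> < 1" "0 < \<beta>" "0 < \<gamma>" and x: "x \<in> tail_region {1, 3}"
  shows "\<exists>w. 0 \<le> w \<and> w \<le> 1 \<and> profile \<alpha> \<beta> \<gamma> w \<le> vine_gauge \<alpha> \<beta> \<gamma> x"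
proof -
  have x': "1 \<le> x $ 1" "0 \<le> x $ 2" "1 \<le> x $ 3" "\<forall>i. 0 \<le> x $ i"
    using x by (auto simp: tail_region_def forall_3)
  have g: "vine_gauge \<alpha> \<beta> \<gamma> x = (1 / \<gamma>) * (1 / \<alpha> - 1) * max (x $ 2 - x $ 1) 0 + x $ 2
     + lnorm \<gamma> (max (x $ 1 - x $ 2) 0 / \<alpha>) (lnorm \<beta> (x $ 2) (x $ 3) - x $ 2)"
    using pars x' by (intro vine_gauge_eq) auto
  have le: "y \<le> lnorm \<beta> y z" if "0 \<le> y" "0 \<le> z" for y z
    using that pars by (simp add: lnorm_ge_left)
  show ?thesis
  proof (cases "1 \<le> x $ 2")
    case True
    have "0 \<le> (1 / \<gamma>) * (1 / \<alpha> - 1) * max (x $ 2 - x $ 1) 0"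
      using pars by (intro mult_nonneg_nonneg) auto
    moreover have "lnorm \<beta> (x $ 2) (x $ 3) - x $ 2
        \<le> lnorm \<gamma> (max (x $ 1 - x $ 2) 0 / \<alpha>) (lnorm \<beta> (x $ 2) (x $ 3) - x $ 2)"
      using pars x' le by (intro lnorm_ge) auto
    moreover have "lnorm \<beta> 1 1 \<le> lnorm \<beta> (x $ 2) (x $ 3)"
      using pars x' True by (intro lnorm_mono) auto
    moreover have "profile \<alpha> \<beta> \<gamma> 1 = lnorm \<beta> 1 1"
      using pars le[of 1 1] by (simp add: profile_def lnorm_zero)
    ultimately have "profile \<alpha> \<beta> \<gamma> 1 \<le> vine_gauge \<alpha> \<beta> \<gamma> x" unfolding g by linarith
    then show ?thesis by (intro exI[of _ 1]) auto
  next
    case False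
    have "lnorm \<beta> 1 (x $ 2) \<le> lnorm \<beta> (x $ 2) (x $ 3)"
      unfolding lnorm_commute[of \<beta> 1] using pars x' by (intro lnorm_mono) auto
    moreover have "x $ 2 \<le> lnorm \<beta> 1 (x $ 2)" using le[of "x $ 2" 1] x' by (simp add: lnorm_commute)
    ultimately have "lnorm \<gamma> ((1 - x $ 2) / \<alpha>) (lnorm \<beta> 1 (x $ 2) - x $ 2)
        \<le> lnorm \<gamma> (max (x $ 1 - x $ 2) 0 / \<alpha>) (lnorm \<beta> (x $ 2) (x $ 3) - x $ 2)"
      using False pars x' by (intro lnorm_mono divide_right_mono) auto
    then have "profile \<alpha> \<beta> \<gamma> (x $ 2) \<le> vine_gauge \<alpha> \<beta> \<gamma> x"
      using False x' unfolding g profile_def by (simp add: max_def)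
    then show ?thesis using False x' by (intro exI[of _ "x $ 2"]) auto
  qed
qed

lemma vine_gauge_profile:
  assumes "v < 1"
  shows "vine_gauge \<alpha> \<beta> \<gamma> (vector [1, v, 1]) = profile \<alpha> \<beta> \<gamma> v"
  using assms by (simp add: vine_gauge_def profile_def lnorm_def add.commute)

theorem mainTheorem9:
  fixes \<alpha> \<beta> \<gamma> :: real
  assumes "0 < \<alpha>" "\<alpha> < 1" "0 < \<beta>" "\<beta> < 1" "0 < \<gamma>" "\<gamma> < 1"
  defines "g \<equiv> vine_gauge \<alpha> \<beta> \<gamma>"
  defines "stationary \<equiv> (\<lambda>v::real.
    1 + (((1 - v) / \<alpha>) powr (1 / \<gamma>)
          + ((1 + v powr (1 / \<beta>)) powr \<beta> - v) powr (1 / \<gamma>)) powr (\<gamma> - 1)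
        * (- (\<alpha> powr (- 1 / \<gamma>)) * (1 - v) powr (- 1 + 1 / \<gamma>)
           + ((1 + v powr (1 / \<beta>)) powr \<beta> - v) powr (- 1 + 1 / \<gamma>)
             * ((1 + v powr (- 1 / \<beta>)) powr (\<beta> - 1) - 1)) = 0)"
  shows "is_gauge_function
           (vine_density (ev_copula (logistic_V \<alpha>)) (inverted_ev_copula (logistic_V \<beta>))
              (inverted_ev_copula (logistic_V \<gamma>))) g
       \<and> (\<exists>m. is_minimum (g ` tail_region {1, 3}) m)
       \<and> (\<exists>v\<in>{0<..<1}. stationary v
            \<and> (\<forall>w\<in>{0<..<1}. stationary w \<longrightarrow> w = v)
            \<and> tail_dep_coeff {1, 3} g = inverse (g (vector [1, v, 1]))
            \<and> g (vector [1, v, 1])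
               = v + (((1 - v) / \<alpha>) powr (1 / \<gamma>)
                      + ((1 + v powr (1 / \<beta>)) powr \<beta> - v) powr (1 / \<gamma>)) powr \<gamma>)"
proof -
  obtain v where v: "0 < v" "v < 1" "slope \<alpha> \<beta> \<gamma> v = 0"
    using slope_root[OF assms(1-6)] by blast
  have stat: "stationary w \<longleftrightarrow> slope \<alpha> \<beta> \<gamma> w = 0" if "0 < w" "w < 1" for w
    unfolding stationary_def slope_eq[OF assms(1,3-6) that] ..
  have less: "profile \<alpha> \<beta> \<gamma> u < profile \<alpha> \<beta> \<gamma> w"
    if "0 < u" "u < 1" "slope \<alpha> \<beta> \<gamma> u = 0" "0 \<le> w" "w \<le> 1" "w \<noteq> u" for u w
    using profile_tangent[of \<alpha> \<beta> \<gamma> u w] assms(1-6) that by simp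
  \<comment> \<open>Two roots would each have a strictly smaller profile value than the other.\<close>
  have unique: "w = v" if "0 < w" "w < 1" "slope \<alpha> \<beta> \<gamma> w = 0" for w
    using less[OF v, of w] less[OF that, of v] that v by (cases "w = v") auto
  have gv: "g (vector [1, v, 1]) = profile \<alpha> \<beta> \<gamma> v"
    using v by (simp add: g_def vine_gauge_profile)
  have min: "is_minimum (g ` tail_region {1, 3}) (g (vector [1, v, 1]))"
    unfolding is_minimum_def
  proof (intro conjI ballI)
    show "g (vector [1, v, 1]) \<in> g ` tail_region {1, 3}"
      using v by (intro imageI) (auto simp: tail_region_def forall_3)
    fix s assume "s \<in> g ` tail_region {1, 3}"
    then obtain x where x: "x \<in> tail_region {1, 3}" "s = g x" by auto
    then obtain w where w: "0 \<le> w" "w \<le> 1" "profile \<alpha> \<beta> \<gamma> w \<le> g x"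
      using vine_gauge_ge_profile[of \<alpha> \<beta> \<gamma> x] assms(1-6) by (auto simp: g_def)
    have "profile \<alpha> \<beta> \<gamma> v \<le> profile \<alpha> \<beta> \<gamma> w"
      using less[of v w] v w by (cases "w = v") auto
    then show "g (vector [1, v, 1]) \<le> s" using w x gv by simp
  qed
  have "(THE m. is_minimum (g ` tail_region {1, 3}) m) = g (vector [1, v, 1])"
    using min by (intro the_equality) (auto simp: is_minimum_def intro: antisym)
  then have coeff: "tail_dep_coeff {1, 3} g = inverse (g (vector [1, v, 1]))"
    by (simp add: tail_dep_coeff_def)
  have value_v: "g (vector [1, v, 1]) = v + (((1 - v) / \<alpha>) powr (1 / \<gamma>)
      + ((1 + v powr (1 / \<beta>)) powr \<beta> - v) powr (1 / \<gamma>)) powr \<gamma>"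
    by (simp add: gv profile_def lnorm_def)
  have root: "stationary v" using stat v by simp
  have only: "\<forall>w\<in>{0<..<1}. stationary w \<longrightarrow> w = v"
  proof (intro ballI impI)
    fix w :: real assume w: "w \<in> {0<..<1}" "stationary w"
    then have "0 < w" "w < 1" by auto
    with w(2) stat unique show "w = v" by simp
  qed
  have "v \<in> {0<..<1}" using v by simp
  with vine_gauge_is_gauge_function[OF assms(1-6), folded g_def] min root only coeff value_v
  show ?thesis by blast
qed

end
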